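(* Let $n,m\in\mathbb{N}_0$ with $n\ge m$, let $\nu\in\mathbb{C}\setminus\{2m,2m+2,2m+4,\dots\}$, let $r,r'\in(0,\infty)$ with $r\ne r'$, and let $\theta'\in(0,\pi)$. Then \[ \int_0^\pi (\chi^2-1)^{(\nu+1)/4}\,Q^{-(\nu+1)/2}_{m-1/2}(\chi)\,\mathrm{P}^m_n(\cos\theta)\,(\sin\theta)^{(\nu+2)/2}\,d\theta =\frac{i\sqrt{\pi}}{2^{(\nu+1)/2}(\sin\theta')^{\nu/2}}\left(\frac{r_>^2-r_<^2}{rr'}\right)^{(\nu+2)/2} Q_n^{-(\nu+2)/2}\!\left(\frac{r^2+r'^2}{2rr'}\right)\mathrm{P}^m_n(\cos\theta'), \] where $\chi=\dfrac{r^2+r'^2-2rr'\cos\theta\cos\theta'}{2rr'\sin\theta\sin\theta'}$ and $r_<=\min\{r,r'\}$, $r_>=\max\{r,r'\}$.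
   Context: For $z\in\mathbb{C}\setminus(-\infty,1]$, $Q^\mu_\nu(z)=e^{\mu\pi i}\frac{\sqrt{\pi}\,\Gamma(\nu+\mu+1)(z^2-1)^{\mu/2}}{2^{\nu+1}z^{\nu+\mu+1}}\,\mathbf{F}\!\left(\frac{\nu+\mu}{2}+1,\frac{\nu+\mu+1}{2};\nu+\frac32;\frac{1}{z^2}\right)$ is the associated Legendre function of the second kind, with $\mathbf{F}(a,b;c;x)={}_2F_1(a,b;c;x)/\Gamma(c)$ and principal branches. $\mathrm{P}^\mu_\nu$ is the Ferrers function of the first kind: for $x\in(-1,1)$, $\mathrm{P}^\mu_\nu(x)=\left(\frac{1+x}{1-x}\right)^{\mu/2}\mathbf{F}\!\left(\nu+1,-\nu;1-\mu;\frac{1-x}{2}\right)$; for integers $0\le m\le n$ this equals $(-1)^m(1-x^2)^{m/2}\frac{d^m}{dx^m}P_n(x)$ with $P_n$ the Legendre polynomial. All non-integer powers of positive reals are the positive ones. *)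

theory Defs
  imports "HOL-Analysis.Analysis"
begin

text \<open>Regularized Gauss hypergeometric function
  F(a,b;c;x) = 2F1(a,b;c;x)/Gamma(c) = sum_k (a)_k (b)_k / (Gamma(c+k) k!) x^k,
  given by its power series (used only for |x| < 1).\<close>
definition hyperF :: "complex \<Rightarrow> complex \<Rightarrow> complex \<Rightarrow> complex \<Rightarrow> complex" where
  "hyperF a b c x =
     (\<Sum>k. pochhammer a k * pochhammer b k * rGamma (c + of_nat k) / fact k * x ^ k)"

definition LegendreQ :: "complex \<Rightarrow> complex \<Rightarrow> complex \<Rightarrow> complex" where
  "LegendreQ mu nu z =
     exp (mu * of_real pi * \<i>) * of_real (sqrt pi) * Gamma (nu + mu + 1)
       * (z\<^sup>2 - 1) powr (mu / 2)
       / (2 powr (nu + 1) * z powr (nu + mu + 1))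
       * hyperF ((nu + mu) / 2 + 1) ((nu + mu + 1) / 2) (nu + 3 / 2) (1 / z\<^sup>2)"

definition FerrersP :: "complex \<Rightarrow> complex \<Rightarrow> real \<Rightarrow> complex" where
  "FerrersP mu nu x =
     complex_of_real ((1 + x) / (1 - x)) powr (mu / 2)
       * hyperF (nu + 1) (- nu) (1 - mu) (complex_of_real ((1 - x) / 2))"

end

theory Submission
  imports Defs "HOL-Computational_Algebra.Polynomial"
begin

text \<open>
  Put \<open>s = - \<nu> / 2\<close> and \<open>z = (r\<^sup>2 + r'\<^sup>2) / (2 r r')\<close>. Up to elementary factors the kernel on the
  left is the \<open>m\<close>-th Fourier coefficient in \<open>\<phi>\<close> of \<open>\<Gamma>(s) (z - cos \<gamma>) powr (- s)\<close>, where
  \<open>cos \<gamma> = cos \<theta> cos \<theta>' + sin \<theta> sin \<theta>' cos \<phi>\<close>, so the identity is an instance of the Funk--Hecke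
  theorem. Expanding in powers of \<open>cos \<gamma>\<close> kills the powers below \<open>m\<close>, so only the values
  \<open>\<Gamma>(s + k)\<close> with \<open>k \<ge> m\<close> occur; this covers all admissible \<open>\<nu>\<close> at once, including those for
  which \<open>\<Gamma>(s)\<close> has a pole.

  For a single power of \<open>cos \<gamma>\<close> the Fourier coefficient divided by \<open>(sin \<theta> sin \<theta>') ^ m\<close> is a
  polynomial kernel in \<open>cos \<theta>\<close> and \<open>cos \<theta>'\<close> on which the Gegenbauer operator
  \<open>(1 - x\<^sup>2) d\<^sup>2 - 2 (m + 1) x d\<close> acts in the same way in either variable. The operator is
  self-adjoint for the weight \<open>(1 - x\<^sup>2) ^ m\<close> and its polynomial eigenfunctions are determined by
  their value at 1, so integration against the Ferrers function reproduces it up to a factor,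
  which Rodrigues' formula turns into a beta integral. Summing the resulting series gives \<open>Q\<close> on
  the right.
\<close>

section \<open>The Gegenbauer operator\<close>

definition gegenbauer_form :: "nat \<Rightarrow> real poly \<Rightarrow> real poly \<Rightarrow> real" where
  "gegenbauer_form m p q =
     integral {0..pi} (\<lambda>t. sin t ^ (2 * m + 1) * (poly p (cos t) * poly q (cos t)))"

definition gegenbauer_adjoint :: "real \<Rightarrow> real poly \<Rightarrow> real poly" where
  "gegenbauer_adjoint a p = [:1, 0, -1:] * pderiv p - smult (2 * (a + 1)) ([:0, 1:] * p)"

definition gegenbauer_op :: "real \<Rightarrow> real poly \<Rightarrow> real poly" where
  "gegenbauer_op a p = gegenbauer_adjoint a (pderiv p)"

lemma poly_gegenbauer_adjoint:
  "poly (gegenbauer_adjoint a p) x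
     = (1 - x * x) * poly (pderiv p) x - 2 * (a + 1) * (x * poly p x)"
  by (simp add: gegenbauer_adjoint_def algebra_simps)

lemma has_integral_gegenbauer_form:
  "((\<lambda>t. sin t ^ (2 * m + 1) * (poly p (cos t) * poly q (cos t)))
     has_integral gegenbauer_form m p q) {0..pi}"
  unfolding gegenbauer_form_def
  by (intro integrable_integral integrable_continuous_real continuous_intros)

lemma gegenbauer_form_commute: "gegenbauer_form m p q = gegenbauer_form m q p"
  by (simp add: gegenbauer_form_def mult.commute)

lemma gegenbauer_form_add_left:
  "gegenbauer_form m (p + q) r = gegenbauer_form m p r + gegenbauer_form m q r"
  using has_integral_add[OF has_integral_gegenbauer_form has_integral_gegenbauer_form]
  by (intro has_integral_unique[OF has_integral_gegenbauer_form]) (simp add: algebra_simps)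

lemma gegenbauer_form_smult_left: "gegenbauer_form m (smult c p) q = c * gegenbauer_form m p q"
  using has_integral_mult_right[OF has_integral_gegenbauer_form, of c m p q]
  by (intro has_integral_unique[OF has_integral_gegenbauer_form]) (simp add: algebra_simps)

lemma gegenbauer_form_smult_right: "gegenbauer_form m p (smult c q) = c * gegenbauer_form m p q"
  using gegenbauer_form_smult_left gegenbauer_form_commute by metis

lemma gegenbauer_form_sum_left:
  "gegenbauer_form m (\<Sum>i\<in>A. f i) q = (\<Sum>i\<in>A. gegenbauer_form m (f i) q)"
  by (induction A rule: infinite_finite_induct)
     (simp_all add: gegenbauer_form_add_left, simp_all add: gegenbauer_form_def)

lemma gegenbauer_form_adjoint:
  "gegenbauer_form m (gegenbauer_adjoint m p) q = - gegenbauer_form (Suc m) p (pderiv q)"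
proof -
  let ?f = "\<lambda>t. sin t ^ (2 * m + 1) * (poly (gegenbauer_adjoint m p) (cos t) * poly q (cos t))
    + sin t ^ (2 * Suc m + 1) * (poly p (cos t) * poly (pderiv q) (cos t))"
  let ?F = "\<lambda>t :: real. - (sin t ^ (2 * m + 2) * (poly p (cos t) * poly q (cos t)))"
  have "(?F has_vector_derivative ?f t) (at t within {0..pi})" for t
  proof -
    have "1 - cos t * cos t = sin t * sin t"
      using sin_cos_squared_add[of t] by (simp add: power2_eq_square)
    then have adjoint: "poly (gegenbauer_adjoint m p) (cos t)
        = sin t * sin t * poly (pderiv p) (cos t) - 2 * (real m + 1) * (cos t * poly p (cos t))"
      by (simp only: poly_gegenbauer_adjoint)
    define S where "S = sin t ^ (2 * m + 1)"
    have powers: "sin t ^ (2 * m + 2) = sin t * S" "sin t ^ (2 * Suc m + 1) = sin t * sin t * S"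
      "sin t ^ (2 * m + 2 - Suc 0) = S" "real (2 * m + 2) = 2 * (real m + 1)"
      by (simp_all add: S_def)
    show ?thesis
      unfolding has_real_derivative_iff_has_vector_derivative[symmetric] adjoint
      by (rule derivative_eq_intros refl)+
         (simp only: powers S_def[symmetric], simp add: algebra_simps)
  qed
  then have "(?f has_integral ?F pi - ?F 0) {0..pi}"
    by (intro fundamental_theorem_of_calculus pi_ge_zero)
  moreover have "(?f has_integral
      gegenbauer_form m (gegenbauer_adjoint m p) q + gegenbauer_form (Suc m) p (pderiv q)) {0..pi}"
    by (intro has_integral_add has_integral_gegenbauer_form)
  ultimately have "?F pi - ?F 0
      = gegenbauer_form m (gegenbauer_adjoint m p) q + gegenbauer_form (Suc m) p (pderiv q)"
    by (rule has_integral_unique)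
  then show ?thesis by simp
qed

lemma gegenbauer_op_selfadjoint:
  "gegenbauer_form m (gegenbauer_op m p) q = gegenbauer_form m p (gegenbauer_op m q)"
  unfolding gegenbauer_op_def gegenbauer_form_commute[of m p] gegenbauer_form_adjoint
  by (subst gegenbauer_form_commute) (rule refl)

lemma gegenbauer_adjoint_smult:
  "gegenbauer_adjoint a (smult c p) = smult c (gegenbauer_adjoint a p)"
  by (intro poly_ext) (simp add: poly_gegenbauer_adjoint pderiv_smult algebra_simps)

lemma gegenbauer_adjoint_diff:
  "gegenbauer_adjoint a (p - q) = gegenbauer_adjoint a p - gegenbauer_adjoint a q"
  by (intro poly_ext) (simp add: poly_gegenbauer_adjoint pderiv_diff algebra_simps)

lemma gegenbauer_op_add: "gegenbauer_op a (p + q) = gegenbauer_op a p + gegenbauer_op a q"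
  by (intro poly_ext) (simp add: gegenbauer_op_def poly_gegenbauer_adjoint pderiv_add algebra_simps)

lemma gegenbauer_op_smult: "gegenbauer_op a (smult c p) = smult c (gegenbauer_op a p)"
  by (simp add: gegenbauer_op_def pderiv_smult gegenbauer_adjoint_smult)

lemma gegenbauer_op_diff: "gegenbauer_op a (p - q) = gegenbauer_op a p - gegenbauer_op a q"
  using gegenbauer_op_add[of a "p - q" q] by simp

lemma gegenbauer_op_sum: "gegenbauer_op a (\<Sum>i\<in>A. f i) = (\<Sum>i\<in>A. gegenbauer_op a (f i))"
  by (induction A rule: infinite_finite_induct)
     (simp_all add: gegenbauer_op_add, simp_all add: gegenbauer_op_def gegenbauer_adjoint_def)

lemma poly_gegenbauer_op_1: "poly (gegenbauer_op a p) 1 = - (2 * (a + 1) * poly (pderiv p) 1)"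
  by (simp add: gegenbauer_op_def poly_gegenbauer_adjoint)

lemma pderiv_gegenbauer_op:
  "pderiv (gegenbauer_op a p) = gegenbauer_op (a + 1) (pderiv p) - smult (2 * (a + 1)) (pderiv p)"
  by (intro poly_ext)
     (simp add: gegenbauer_op_def gegenbauer_adjoint_def pderiv_diff pderiv_mult pderiv_smult
       pderiv_pCons algebra_simps del: mult_pCons_left mult_pCons_right)

text \<open>By \<open>pderiv_gegenbauer_op\<close> the derivative is again an eigenfunction, of the operator with
  \<open>a\<close> raised by one; by \<open>poly_gegenbauer_op_1\<close> it vanishes at 1 as well.\<close>
lemma gegenbauer_op_eigen_eq_0:
  assumes "a > - 1" and "gegenbauer_op a p = smult c p" and "poly p 1 = 0"
  shows "p = 0"
  using assms
proof (induction "degree p" arbitrary: p a c rule: less_induct)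
  case less
  show ?case
  proof (cases "degree p = 0")
    case True
    then show ?thesis using less.prems(3) by (auto elim: degree_eq_zeroE)
  next
    case False
    have "poly (pderiv p) 1 = 0"
      using poly_gegenbauer_op_1[of a p] less.prems by simp
    moreover have "gegenbauer_op (a + 1) (pderiv p) = smult (c + 2 * (a + 1)) (pderiv p)"
      using pderiv_gegenbauer_op[of a p] less.prems(2)
      by (simp add: pderiv_smult smult_add_left diff_eq_eq)
    moreover have "degree (pderiv p) < degree p"
      using False by (simp add: degree_pderiv)
    moreover have "a + 1 > - 1"
      using less.prems(1) by simp
    ultimately have "pderiv p = 0"
      using less.hyps by blast
    with False show ?thesis by (simp add: pderiv_eq_0_iff)
  qed
qed

lemma gegenbauer_op_eigen_unique:
  assumes "a > - 1" and "gegenbauer_op a p = smult c p" and "gegenbauer_op a q = smult c q"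
  shows "smult (poly q 1) p = smult (poly p 1) q"
proof -
  let ?d = "smult (poly q 1) p - smult (poly p 1) q"
  have "gegenbauer_op a ?d = smult c ?d"
    using assms by (simp add: gegenbauer_op_diff gegenbauer_op_smult smult_diff_right mult.commute)
  then have "?d = 0"
    using assms(1) by (intro gegenbauer_op_eigen_eq_0[of a _ c]) simp_all
  then show ?thesis by simp
qed

text \<open>The Funk--Hecke principle for the kernel \<open>\<Sum>i\<in>I. a i (x) * b i (y)\<close>, on which the operator
  acts in the same way in either variable.\<close>
lemma gegenbauer_form_symmetric_kernel:
  assumes symmetric: "\<And>y. (\<Sum>i\<in>I. smult (poly (b i) y) (gegenbauer_op m (a i)))
      = (\<Sum>i\<in>I. smult (poly (gegenbauer_op m (b i)) y) (a i))"
    and eigen: "gegenbauer_op m p = smult c p"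
  shows "poly p 1 * (\<Sum>i\<in>I. gegenbauer_form m (a i) p * poly (b i) y)
    = (\<Sum>i\<in>I. gegenbauer_form m (a i) p * poly (b i) 1) * poly p y"
proof -
  define F where "F = (\<Sum>i\<in>I. smult (gegenbauer_form m (a i) p) (b i))"
  have "gegenbauer_op m F = smult c F"
  proof (rule poly_ext)
    fix x
    have "poly (gegenbauer_op m F) x
        = gegenbauer_form m (\<Sum>i\<in>I. smult (poly (gegenbauer_op m (b i)) x) (a i)) p"
      by (simp add: F_def gegenbauer_op_sum gegenbauer_op_smult poly_sum gegenbauer_form_sum_left
          gegenbauer_form_smult_left mult.commute)
    also have "\<dots> = gegenbauer_form m (gegenbauer_op m (\<Sum>i\<in>I. smult (poly (b i) x) (a i))) p"
      by (simp add: symmetric[symmetric] gegenbauer_op_sum gegenbauer_op_smult)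
    also have "\<dots> = c * gegenbauer_form m (\<Sum>i\<in>I. smult (poly (b i) x) (a i)) p"
      by (simp add: gegenbauer_op_selfadjoint eigen gegenbauer_form_smult_right)
    also have "\<dots> = poly (smult c F) x"
      by (simp add: F_def poly_sum gegenbauer_form_sum_left gegenbauer_form_smult_left mult.commute)
    finally show "poly (gegenbauer_op m F) x = poly (smult c F) x" .
  qed
  with eigen have "smult (poly p 1) F = smult (poly F 1) p"
    by (intro gegenbauer_op_eigen_unique[of m _ c]) simp_all
  then have "poly p 1 * poly F y = poly F 1 * poly p y"
    by (metis poly_smult)
  then show ?thesis by (simp add: F_def poly_sum)
qed

definition gegenbauer_monomial :: "nat \<Rightarrow> nat \<Rightarrow> real poly" where
  "gegenbauer_monomial j l = [:1, 0, -1:] ^ j * monom 1 l"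

lemma poly_gegenbauer_monomial [simp]: "poly (gegenbauer_monomial j l) x = (1 - x * x) ^ j * x ^ l"
  by (simp add: gegenbauer_monomial_def poly_monom)

lemma pderiv_gegenbauer_monomial:
  "pderiv (gegenbauer_monomial j l) = smult (real l) (gegenbauer_monomial j (l - 1))
     - smult (2 * real j) (gegenbauer_monomial (j - 1) (Suc l))"
  by (intro poly_ext)
     (simp add: gegenbauer_monomial_def pderiv_mult pderiv_power pderiv_monom pderiv_pCons
       poly_monom algebra_simps)

lemma gegenbauer_adjoint_monomial:
  "gegenbauer_adjoint a (gegenbauer_monomial j l) =
     smult (real l) (gegenbauer_monomial (Suc j) (l - 1))
     - smult (2 * (real j + a + 1)) (gegenbauer_monomial j (Suc l))"
  by (intro poly_ext; cases j)
     (simp_all add: poly_gegenbauer_adjoint pderiv_gegenbauer_monomial algebra_simps)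

lemma gegenbauer_op_monomial:
  "gegenbauer_op a (gegenbauer_monomial j l) =
     smult (4 * real j * (real j + a)) (gegenbauer_monomial (j - 1) (l + 2))
     + smult (real l * (real l - 1)) (gegenbauer_monomial (Suc j) (l - 2))
     - smult (2 * real j * (real l + 1) + 2 * real l * (real j + a + 1))
         (gegenbauer_monomial j l)"
  unfolding gegenbauer_op_def pderiv_gegenbauer_monomial gegenbauer_adjoint_diff
    gegenbauer_adjoint_smult gegenbauer_adjoint_monomial
  by (intro poly_ext; cases j; cases l) (simp_all add: algebra_simps)

section \<open>The polynomial factor of the Ferrers function\<close>

definition ferrers_arg :: "real poly" where
  "ferrers_arg = [:1 / 2, - (1 / 2):]"

lemma poly_ferrers_arg [simp]: "poly ferrers_arg x = (1 - x) / 2"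
  by (simp add: ferrers_arg_def field_simps)

definition ferrers_coeff :: "nat \<Rightarrow> nat \<Rightarrow> nat \<Rightarrow> real" where
  "ferrers_coeff n m i = pochhammer (real n + 1) (m + i) * pochhammer (- real n) (m + i)
     / (2 ^ m * fact i * fact (m + i))"

text \<open>Up to the sign \<open>(-1) ^ m\<close> this is the \<open>m\<close>-th derivative of the Legendre polynomial of
  degree \<open>n\<close>, expanded at 1.\<close>
definition ferrers_poly :: "nat \<Rightarrow> nat \<Rightarrow> real poly" where
  "ferrers_poly n m = (\<Sum>i\<le>n. smult (ferrers_coeff n m i) (ferrers_arg ^ i))"

lemma ferrers_coeff_eq_0: "n < m + i \<Longrightarrow> ferrers_coeff n m i = 0"
  by (simp add: ferrers_coeff_def pochhammer_of_nat_eq_0_iff)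

lemma ferrers_coeff_Suc:
  "(real i + 1) * (real i + 1 + real m) * ferrers_coeff n m (Suc i)
     = (real n + 1 + real m + real i) * (real m + real i - real n) * ferrers_coeff n m i"
  by (simp add: ferrers_coeff_def pochhammer_Suc divide_simps) (simp add: algebra_simps)

lemma poly_ferrers_poly:
  "poly (ferrers_poly n m) x = (\<Sum>i\<le>n. ferrers_coeff n m i * ((1 - x) / 2) ^ i)"
  by (simp add: ferrers_poly_def poly_sum)

lemma poly_ferrers_poly_1_neq_0:
  assumes "m \<le> n"
  shows "poly (ferrers_poly n m) 1 \<noteq> 0"
proof -
  have "poly (ferrers_poly n m) 1 = ferrers_coeff n m 0"
    by (simp add: poly_ferrers_poly power_0_left if_distrib[of "(*) _"] cong: if_cong)
  moreover have "pochhammer (real n + 1) m \<noteq> 0"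
    using pochhammer_pos[of "real n + 1" m] by simp
  ultimately show ?thesis
    using assms by (simp add: ferrers_coeff_def pochhammer_of_nat_eq_0_iff)
qed

lemma pderiv_ferrers_arg_power:
  "pderiv (ferrers_arg ^ i) = smult (- (real i / 2)) (ferrers_arg ^ (i - 1))"
  by (simp add: ferrers_arg_def pderiv_power pderiv_pCons)

lemma gegenbauer_adjoint_ferrers_arg_power:
  "gegenbauer_adjoint a (ferrers_arg ^ i) =
     smult (2 * (real i + 2 * a + 2)) (ferrers_arg ^ Suc i)
     - smult (2 * (real i + a + 1)) (ferrers_arg ^ i)"
proof (rule poly_ext)
  fix x :: real
  define u where "u = (1 - x) / 2"
  have x_eq: "x = 1 - 2 * u" and poly_arg: "poly ferrers_arg x = u"
    by (simp_all add: u_def field_simps)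
  show "poly (gegenbauer_adjoint a (ferrers_arg ^ i)) x = poly (
      smult (2 * (real i + 2 * a + 2)) (ferrers_arg ^ Suc i)
      - smult (2 * (real i + a + 1)) (ferrers_arg ^ i)) x"
    unfolding poly_gegenbauer_adjoint pderiv_ferrers_arg_power poly_smult poly_power poly_diff
      poly_arg
    unfolding x_eq by (cases i) (simp_all add: field_simps)
qed

lemma gegenbauer_op_ferrers_arg_power:
  "gegenbauer_op a (ferrers_arg ^ i) =
     smult (real i * (real i + a)) (ferrers_arg ^ (i - 1))
     - smult (real i * (real i + 2 * a + 1)) (ferrers_arg ^ i)"
proof (cases i)
  case (Suc j)
  show ?thesis
    unfolding Suc gegenbauer_op_def pderiv_ferrers_arg_power gegenbauer_adjoint_smult
      gegenbauer_adjoint_ferrers_arg_power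
    by (intro poly_ext) (simp add: field_simps del: poly_ferrers_arg)
qed (simp add: gegenbauer_op_def gegenbauer_adjoint_def)

lemma gegenbauer_op_ferrers_poly:
  "gegenbauer_op m (ferrers_poly n m)
     = smult (- ((real n - real m) * (real n + real m + 1))) (ferrers_poly n m)"
proof (rule poly_ext)
  fix x :: real
  let ?a = "ferrers_coeff n m" and ?u = "(1 - x) / 2"
  have "poly (gegenbauer_op m (ferrers_poly n m)) x =
      (\<Sum>i\<le>n. ?a i * (real i * (real i + real m)) * ?u ^ (i - 1))
      - (\<Sum>i\<le>n. ?a i * (real i * (real i + 2 * real m + 1)) * ?u ^ i)"
    by (simp add: ferrers_poly_def gegenbauer_op_sum gegenbauer_op_smult poly_sum
        gegenbauer_op_ferrers_arg_power sum_subtractf right_diff_distrib mult.assoc)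
  also have "(\<Sum>i\<le>n. ?a i * (real i * (real i + real m)) * ?u ^ (i - 1))
      = (\<Sum>i\<le>Suc n. ?a i * (real i * (real i + real m)) * ?u ^ (i - 1))"
    by (simp add: ferrers_coeff_eq_0)
  also have "\<dots> = (\<Sum>i\<le>n. ((real i + 1) * (real i + 1 + real m) * ?a (Suc i)) * ?u ^ i)"
    by (subst sum.atMost_Suc_shift) (simp add: mult_ac add_ac)
  also have "\<dots> = (\<Sum>i\<le>n. (real n + 1 + real m + real i) * (real m + real i - real n) * ?a i
      * ?u ^ i)"
    by (simp only: ferrers_coeff_Suc)
  also have "\<dots> - (\<Sum>i\<le>n. ?a i * (real i * (real i + 2 * real m + 1)) * ?u ^ i)
      = (\<Sum>i\<le>n. - ((real n - real m) * (real n + real m + 1)) * (?a i * ?u ^ i))"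
    by (subst sum_subtractf[symmetric], rule sum.cong) (simp_all add: algebra_simps)
  also have "\<dots> = poly (smult (- ((real n - real m) * (real n + real m + 1))) (ferrers_poly n m)) x"
    by (simp only: poly_smult poly_ferrers_poly sum_distrib_left)
  finally show "poly (gegenbauer_op m (ferrers_poly n m)) x = \<dots>" .
qed

lemma pderiv_ferrers_poly: "pderiv (ferrers_poly n m) = - ferrers_poly n (Suc m)"
proof (rule poly_ext)
  fix x :: real
  have coeff_Suc: "ferrers_coeff n m (Suc i) * real (Suc i) = 2 * ferrers_coeff n (Suc m) i" for i
    by (simp add: ferrers_coeff_def divide_simps)
  have "poly (pderiv (ferrers_poly n m)) x
      = (\<Sum>i\<le>n. ferrers_coeff n m i * (- (real i / 2)) * ((1 - x) / 2) ^ (i - 1))"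
    by (simp add: ferrers_poly_def pderiv_smult higher_pderiv_sum[of 1, simplified] poly_sum
        pderiv_ferrers_arg_power mult.assoc)
  also have "\<dots> = (\<Sum>i\<le>Suc n. ferrers_coeff n m i * (- (real i / 2)) * ((1 - x) / 2) ^ (i - 1))"
    by (simp add: ferrers_coeff_eq_0)
  also have "\<dots> = (\<Sum>i\<le>n. - ferrers_coeff n (Suc m) i * ((1 - x) / 2) ^ i)"
    by (subst sum.atMost_Suc_shift) (simp add: coeff_Suc del: of_nat_Suc)
  also have "\<dots> = poly (- ferrers_poly n (Suc m)) x"
    by (simp add: poly_ferrers_poly sum_negf)
  finally show "poly (pderiv (ferrers_poly n m)) x = poly (- ferrers_poly n (Suc m)) x" .
qed

lemma ferrers_poly_diagonal: "ferrers_poly n n = [:poly (ferrers_poly n n) 1:]"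
proof -
  have "pderiv (ferrers_poly n n) = 0"
    by (simp add: pderiv_ferrers_poly) (simp add: ferrers_poly_def ferrers_coeff_eq_0)
  then obtain a where "ferrers_poly n n = [:a:]"
    by (auto simp: pderiv_eq_0_iff elim: degree_eq_zeroE)
  then show ?thesis by simp
qed

lemma gegenbauer_form_ferrers_poly_Suc:
  assumes "m < n"
  shows "gegenbauer_form m q (ferrers_poly n m) = poly (ferrers_poly n m) 1
    * (gegenbauer_form (Suc m) (pderiv q) (ferrers_poly n (Suc m))
       / (2 * (real m + 1) * poly (ferrers_poly n (Suc m)) 1))"
proof -
  define c where "c = - ((real n - real m) * (real n + real m + 1))"
  have "c \<noteq> 0" using assms by (simp add: c_def)
  have "c * gegenbauer_form m q (ferrers_poly n m)
      = gegenbauer_form m (gegenbauer_op m (ferrers_poly n m)) q"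
    unfolding gegenbauer_op_ferrers_poly c_def gegenbauer_form_smult_left
    by (simp only: gegenbauer_form_commute[of m q])
  also have "\<dots> = gegenbauer_form (Suc m) (pderiv q) (ferrers_poly n (Suc m))"
    unfolding gegenbauer_op_def gegenbauer_form_adjoint pderiv_ferrers_poly
    using gegenbauer_form_smult_left[of "Suc m" "-1"] by (simp add: gegenbauer_form_commute)
  finally have raised_form: "c * gegenbauer_form m q (ferrers_poly n m)
    = gegenbauer_form (Suc m) (pderiv q) (ferrers_poly n (Suc m))" .
  have "c * poly (ferrers_poly n m) 1 = poly (gegenbauer_op m (ferrers_poly n m)) 1"
    by (simp add: gegenbauer_op_ferrers_poly c_def)
  also have "\<dots> = 2 * (real m + 1) * poly (ferrers_poly n (Suc m)) 1"
    by (simp add: poly_gegenbauer_op_1 pderiv_ferrers_poly)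
  finally have raised_at_1: "c * poly (ferrers_poly n m) 1
    = 2 * (real m + 1) * poly (ferrers_poly n (Suc m)) 1" .
  have "poly (ferrers_poly n m) 1 \<noteq> 0"
    using assms by (intro poly_ferrers_poly_1_neq_0) simp
  with \<open>c \<noteq> 0\<close> show ?thesis
    by (simp only: raised_form[symmetric] raised_at_1[symmetric]) simp
qed

lemma gegenbauer_form_ferrers_poly_Rodrigues:
  assumes "m \<le> n"
  shows "gegenbauer_form m q (ferrers_poly n m) = poly (ferrers_poly n m) 1
    * (fact m / (2 ^ (n - m) * fact n) * gegenbauer_form n ((pderiv ^^ (n - m)) q) 1)"
  using assms
proof (induction m arbitrary: q rule: inc_induct)
  case base
  show ?case
    using gegenbauer_form_smult_right[of n q "poly (ferrers_poly n n) 1" 1]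
    by (subst ferrers_poly_diagonal) (simp add: one_pCons)
next
  case (step m)
  define k where "k = n - Suc m"
  have diff_eq: "n - m = Suc k" using step.hyps by (simp add: k_def)
  have "poly (ferrers_poly n (Suc m)) 1 \<noteq> 0"
    using step.hyps by (intro poly_ferrers_poly_1_neq_0) simp
  moreover have "m < n"
    using step.hyps by simp
  moreover have "gegenbauer_form (Suc m) (pderiv q) (ferrers_poly n (Suc m)) =
      poly (ferrers_poly n (Suc m)) 1 * ((real m + 1) * fact m / (2 ^ k * fact n)
        * gegenbauer_form n ((pderiv ^^ Suc k) q) 1)"
    by (simp only: step.IH k_def[symmetric] funpow_Suc_right o_apply fact_Suc) simp
  ultimately show ?case
    unfolding diff_eq by (simp only: gegenbauer_form_ferrers_poly_Suc) (simp add: divide_simps)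
qed

section \<open>The Funk--Hecke formula for powers\<close>

lemma gegenbauer_form_eq_mult_1: "gegenbauer_form m p q = gegenbauer_form m (p * q) 1"
  by (simp add: gegenbauer_form_def)

lemma gegenbauer_form_0_monom: "gegenbauer_form 0 (monom 1 k) 1 = (1 + (- 1) ^ k) / (real k + 1)"
proof -
  let ?F = "\<lambda>t :: real. - (cos t ^ Suc k) / (real k + 1)"
  have "((\<lambda>t. sin t ^ (2 * 0 + 1) * (poly (monom 1 k) (cos t) * poly 1 (cos t))) has_integral
      ?F pi - ?F 0) {0..pi}"
  proof (intro fundamental_theorem_of_calculus pi_ge_zero)
    show "(?F has_vector_derivative
        sin t ^ (2 * 0 + 1) * (poly (monom 1 k) (cos t) * poly 1 (cos t))) (at t within {0..pi})"
      for t
      unfolding has_real_derivative_iff_has_vector_derivative[symmetric]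
      by (rule derivative_eq_intros refl | simp)+ (simp add: poly_monom field_simps)
  qed
  then have "gegenbauer_form 0 (monom 1 k) 1 = ?F pi - ?F 0"
    by (rule has_integral_unique[OF has_integral_gegenbauer_form])
  then show ?thesis by (simp add: add_divide_distrib)
qed

lemma gegenbauer_form_monom_Suc:
  "(real k + 1) * gegenbauer_form (Suc n) (monom 1 k) 1
     = 2 * (real n + 1) * gegenbauer_form n (monom 1 (k + 2)) 1"
proof -
  have "(real k + 1) * gegenbauer_form (Suc n) (monom 1 k) 1
      = gegenbauer_form (Suc n) 1 (pderiv (monom 1 (Suc k)))"
    using gegenbauer_form_smult_left[of "Suc n" "real k + 1" "monom 1 k" 1]
    by (simp add: pderiv_monom smult_monom gegenbauer_form_commute[of _ 1] add_ac)
  also have "\<dots> = - gegenbauer_form n (gegenbauer_adjoint n 1) (monom 1 (Suc k))"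
    by (simp add: gegenbauer_form_adjoint)
  also have "gegenbauer_adjoint n 1 = smult (- 2 * (real n + 1)) [:0, 1:]"
    by (simp add: gegenbauer_adjoint_def)
  also have "- gegenbauer_form n \<dots> (monom 1 (Suc k))
      = 2 * (real n + 1) * gegenbauer_form n ([:0, 1:] * monom 1 (Suc k)) 1"
    by (simp only: gegenbauer_form_smult_left gegenbauer_form_eq_mult_1[of n "[:0, 1:]"])
  also have "[:0, 1:] * monom 1 (Suc k) = (monom 1 (k + 2) :: real poly)"
    by (simp add: monom_Suc)
  finally show ?thesis .
qed

lemma gegenbauer_form_monom_even:
  "gegenbauer_form n (monom 1 (2 * j)) 1
     = fact n * Gamma (real j + 1 / 2) * rGamma (real n + 3 / 2 + real j)"
proof (induction n arbitrary: j)
  case 0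
  have "rGamma (real j + 1 / 2) \<noteq> 0"
    using nonpos_Ints_nonpos[of "real j + 1 / 2"] by (auto simp: rGamma_eq_zero_iff)
  moreover have "(real j + 1 / 2) * rGamma (real j + 1 / 2 + 1) = rGamma (real j + 1 / 2)"
    by (rule rGamma_plus1)
  ultimately show ?case
    unfolding Gamma_def by (simp add: gegenbauer_form_0_monom field_simps)
next
  case (Suc n)
  have "(2 * real j + 1) * gegenbauer_form (Suc n) (monom 1 (2 * j)) 1
      = 2 * (real n + 1) * gegenbauer_form n (monom 1 (2 * Suc j)) 1"
    using gegenbauer_form_monom_Suc[of "2 * j" n] by simp
  also have "\<dots> = 2 * (real n + 1)
      * (fact n * Gamma (real j + 1 / 2 + 1) * rGamma (real n + 3 / 2 + real (Suc j)))"
    by (simp only: Suc) (simp add: add_ac)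
  also have "Gamma (real j + 1 / 2 + 1) = (real j + 1 / 2) * Gamma (real j + 1 / 2)"
    using nonpos_Ints_nonpos[of "real j + 1 / 2"] by (intro Gamma_plus1) force
  also have "2 * (real n + 1) * (fact n * ((real j + 1 / 2) * Gamma (real j + 1 / 2))
      * rGamma (real n + 3 / 2 + real (Suc j)))
    = (2 * real j + 1)
      * (fact (Suc n) * Gamma (real j + 1 / 2) * rGamma (real (Suc n) + 3 / 2 + real j))"
    by (simp add: field_simps)
  finally show ?case by simp
qed

lemma gegenbauer_form_monom_odd:
  assumes "odd k"
  shows "gegenbauer_form n (monom 1 k) 1 = 0"
  using assms
proof (induction n arbitrary: k)
  case (Suc n)
  then have "(real k + 1) * gegenbauer_form (Suc n) (monom 1 k) 1 = 0"
    by (simp add: gegenbauer_form_monom_Suc)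
  moreover have "real k + 1 \<noteq> 0"
    by linarith
  ultimately show ?case
    by (metis mult_eq_0_iff)
qed (simp add: gegenbauer_form_0_monom)

lemma higher_pderiv_monom_1:
  "(pderiv ^^ k) (monom 1 N) =
     (if k \<le> N then smult (fact N / fact (N - k)) (monom 1 (N - k)) else (0 :: real poly))"
proof (induction k)
  case (Suc k)
  show ?case
  proof (cases "Suc k \<le> N")
    case True
    then obtain l where "N = k + Suc l"
      by (metis add_Suc_right add_Suc le_Suc_ex)
    with Suc show ?thesis
      by (simp add: pderiv_smult pderiv_monom smult_monom)
  next
    case False
    with Suc show ?thesis by (cases "k = N") (simp_all add: pderiv_monom)
  qed
qed simp

definition funk_hecke_coeff :: "nat \<Rightarrow> nat \<Rightarrow> nat \<Rightarrow> real" where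
  "funk_hecke_coeff n m N =
     gegenbauer_form n ((pderiv ^^ (n - m)) (monom 1 N)) 1 / (2 ^ n * fact n * fact N)"

lemma funk_hecke_coeff_even:
  "funk_hecke_coeff n m (n - m + 2 * j)
     = sqrt pi / 2 ^ n * (rGamma (real n + 3 / 2 + real j) / (4 ^ j * fact j))"
proof -
  have "Gamma (real j + 1 / 2) = sqrt pi * pochhammer (1 / 2) j"
    using nonpos_Ints_nonpos[of "1 / 2 :: real"]
    by (subst pochhammer_Gamma) (auto simp: Gamma_one_half_real add_ac)
  also have "pochhammer (1 / 2 :: real) j = fact (2 * j) / (4 ^ j * fact j)"
    by (simp add: fact_double power_mult)
  finally have Gamma_half: "Gamma (real j + 1 / 2) = sqrt pi * (fact (2 * j) / (4 ^ j * fact j))" .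
  have "funk_hecke_coeff n m (n - m + 2 * j)
      = gegenbauer_form n (monom 1 (2 * j)) 1 / (2 ^ n * fact n * fact (2 * j))"
    by (simp add: funk_hecke_coeff_def higher_pderiv_monom_1 gegenbauer_form_smult_left)
  then show ?thesis
    by (simp add: gegenbauer_form_monom_even Gamma_half)
qed

lemma funk_hecke_coeff_eq_0:
  assumes "N \<notin> range (\<lambda>j. n - m + 2 * j)"
  shows "funk_hecke_coeff n m N = 0"
proof (cases "n - m \<le> N")
  case True
  have "odd (N - (n - m))"
  proof
    assume "even (N - (n - m))"
    then obtain j where "N - (n - m) = 2 * j" by (rule evenE)
    with True have "N = n - m + 2 * j" by simp
    with assms show False by blast
  qed
  with True show ?thesis
    by (simp add: funk_hecke_coeff_def higher_pderiv_monom_1 gegenbauer_form_smult_left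
        gegenbauer_form_monom_odd del: even_diff_nat)
qed (simp add: funk_hecke_coeff_def higher_pderiv_monom_1 gegenbauer_form_def)

lemma sum_shift_neutral:
  fixes f g :: "nat \<Rightarrow> 'a :: comm_monoid_add"
  assumes "f 0 = 0" and "g J = 0" and "\<And>j. j < J \<Longrightarrow> f (Suc j) = g j"
  shows "sum f {..J} = sum g {..J}"
proof -
  have "sum f {..J} = (\<Sum>j<J. f (Suc j))"
    using assms(1) by (simp add: sum.atMost_shift)
  also have "\<dots> = sum g {..<J}"
    using assms(3) by simp
  also have "\<dots> = sum g {..J}"
    using assms(2) by (simp flip: lessThan_Suc_atMost)
  finally show ?thesis .
qed

definition sphere_coeff :: "nat \<Rightarrow> nat \<Rightarrow> nat \<Rightarrow> real" where
  "sphere_coeff m N j = 1 / (4 ^ j * fact j * fact (m + j) * fact (N - 2 * j))"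

definition sphere_basis :: "nat \<Rightarrow> nat \<Rightarrow> real poly" where
  "sphere_basis N j = gegenbauer_monomial j (N - 2 * j)"

lemma sphere_coeff_Suc:
  assumes "j < N div 2"
  shows "sphere_coeff m N (Suc j) * (4 * real (Suc j) * (real (Suc j) + real m))
    = sphere_coeff m N j * (real (N - 2 * j) * (real (N - 2 * j) - 1))"
proof -
  have "N - 2 * j = Suc (Suc (N - 2 * Suc j))"
    using assms by arith
  then obtain l where exponents: "N - 2 * j = Suc (Suc l)" "N - 2 * Suc j = l"
    by blast
  show ?thesis
    unfolding sphere_coeff_def exponents by (simp add: divide_simps) (simp add: algebra_simps)
qed

lemma gegenbauer_op_sphere_basis:
  assumes "j \<le> N div 2"
  shows "gegenbauer_op m (sphere_basis N j) =
     smult (4 * real j * (real j + real m)) (sphere_basis N (j - 1))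
     + smult (real (N - 2 * j) * (real (N - 2 * j) - 1)) (sphere_basis N (Suc j))
     - smult (2 * real j * (real (N - 2 * j) + 1) + 2 * real (N - 2 * j) * (real j + real m + 1))
         (sphere_basis N j)"
proof -
  have "N - 2 * j + 2 = N - 2 * (j - 1) \<or> j = 0" and "N - 2 * j - 2 = N - 2 * Suc j"
    using assms by auto
  then show ?thesis
    unfolding sphere_basis_def gegenbauer_op_monomial by (elim disjE) simp_all
qed

lemma sphere_kernel_symmetric:
  "(\<Sum>j\<le>N div 2. smult (poly (sphere_basis N j) y)
       (gegenbauer_op m (smult (sphere_coeff m N j) (sphere_basis N j))))
   = (\<Sum>j\<le>N div 2. smult (poly (gegenbauer_op m (sphere_basis N j)) y)
       (smult (sphere_coeff m N j) (sphere_basis N j)))"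
proof (rule poly_ext)
  fix x
  define J where "J = N div 2"
  let ?c = "sphere_coeff m N" and ?b = "\<lambda>x j. poly (sphere_basis N j) x"
  define \<alpha> \<gamma> \<beta> where "\<alpha> j = 4 * real j * (real j + real m)"
    and "\<gamma> j = real (N - 2 * j) * (real (N - 2 * j) - 1)"
    and "\<beta> j = 2 * real j * (real (N - 2 * j) + 1) + 2 * real (N - 2 * j) * (real j + real m + 1)"
    for j
  have three_terms: "poly (gegenbauer_op m (sphere_basis N j)) t
      = \<alpha> j * ?b t (j - 1) + \<gamma> j * ?b t (Suc j) - \<beta> j * ?b t j" if "j \<le> J" for j t
    using that by (simp add: J_def gegenbauer_op_sphere_basis \<alpha>_def \<beta>_def \<gamma>_def)
  have shift: "(\<Sum>j\<le>J. ?c j * \<alpha> j * (?b s (j - 1) * ?b t j))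
      = (\<Sum>j\<le>J. ?c j * \<gamma> j * (?b s j * ?b t (Suc j)))" for s t
  proof (rule sum_shift_neutral)
    have "N - 2 * J = 0 \<or> N - 2 * J = 1" unfolding J_def by arith
    then show "?c J * \<gamma> J * (?b s J * ?b t (Suc J)) = 0" by (auto simp: \<gamma>_def)
    show "?c (Suc j) * \<alpha> (Suc j) * (?b s (Suc j - 1) * ?b t (Suc j))
        = ?c j * \<gamma> j * (?b s j * ?b t (Suc j))"
      if "j < J" for j
      using sphere_coeff_Suc[of j N m] that by (simp add: \<alpha>_def \<gamma>_def J_def)
  qed (simp add: \<alpha>_def)
  have expand: "(\<Sum>j\<le>J. ?c j * ?b t j * poly (gegenbauer_op m (sphere_basis N j)) s)
      = (\<Sum>j\<le>J. ?c j * \<alpha> j * (?b s (j - 1) * ?b t j))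
        + (\<Sum>j\<le>J. ?c j * \<gamma> j * (?b t j * ?b s (Suc j)))
        - (\<Sum>j\<le>J. ?c j * \<beta> j * (?b s j * ?b t j))" for s t
    unfolding sum.distrib[symmetric] sum_subtractf[symmetric]
    by (intro sum.cong) (simp_all add: three_terms algebra_simps)
  have "(\<Sum>j\<le>J. ?c j * ?b y j * poly (gegenbauer_op m (sphere_basis N j)) x)
      = (\<Sum>j\<le>J. ?c j * ?b x j * poly (gegenbauer_op m (sphere_basis N j)) y)"
    unfolding expand shift by (simp add: mult.commute)
  then show "poly (\<Sum>j\<le>N div 2. smult (?b y j) (gegenbauer_op m (smult (?c j) (sphere_basis N j)))) x
      = poly (\<Sum>j\<le>N div 2. smult (poly (gegenbauer_op m (sphere_basis N j)) y)
          (smult (?c j) (sphere_basis N j))) x"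
    by (simp add: poly_sum gegenbauer_op_smult J_def mult_ac)
qed

lemma gegenbauer_form_sphere_kernel:
  assumes "m \<le> n"
  shows "(\<Sum>j\<le>N div 2. sphere_coeff m N j * gegenbauer_form m (sphere_basis N j) (ferrers_poly n m)
      * poly (sphere_basis N j) y)
    = 2 ^ m * funk_hecke_coeff n m N * poly (ferrers_poly n m) y"
proof -
  let ?p = "ferrers_poly n m" and ?c = "sphere_coeff m N" and ?b = "sphere_basis N"
  have "poly ?p 1 * (\<Sum>j\<le>N div 2. gegenbauer_form m (smult (?c j) (?b j)) ?p * poly (?b j) y)
      = (\<Sum>j\<le>N div 2. gegenbauer_form m (smult (?c j) (?b j)) ?p * poly (?b j) 1) * poly ?p y"
    by (intro gegenbauer_form_symmetric_kernel[OF _ gegenbauer_op_ferrers_poly]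
        sphere_kernel_symmetric)
  also have "(\<Sum>j\<le>N div 2. gegenbauer_form m (smult (?c j) (?b j)) ?p * poly (?b j) 1)
      = (\<Sum>j\<le>N div 2. if j = 0 then gegenbauer_form m (smult (?c 0) (?b 0)) ?p else 0)"
    by (intro sum.cong) (auto simp: sphere_basis_def)
  also have "\<dots> = poly ?p 1 * (2 ^ m * funk_hecke_coeff n m N)"
  proof -
    have "(2 :: real) ^ n = 2 ^ (n - m) * 2 ^ m"
      using assms by (simp flip: power_add)
    then show ?thesis
      by (simp add: sphere_coeff_def sphere_basis_def gegenbauer_monomial_def funk_hecke_coeff_def
          gegenbauer_form_smult_left gegenbauer_form_ferrers_poly_Rodrigues[OF assms])
  qed
  finally show ?thesis
    using poly_ferrers_poly_1_neq_0[OF assms] by (simp add: gegenbauer_form_smult_left mult_ac)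
qed

text \<open>The terms of the series of the modified Bessel function \<open>I\<^sub>m(B)\<close>.\<close>
definition bessel_term :: "nat \<Rightarrow> nat \<Rightarrow> real \<Rightarrow> real" where
  "bessel_term m j B = (B / 2) ^ (m + 2 * j) / (fact j * fact (m + j))"

text \<open>\<open>(m + N)!\<close> times this is the \<open>m\<close>-th Fourier coefficient of
  \<open>(D + B cos \<phi>) ^ (m + N)\<close>.\<close>
definition fourier_coeff :: "nat \<Rightarrow> nat \<Rightarrow> real \<Rightarrow> real \<Rightarrow> real" where
  "fourier_coeff m N D B = (\<Sum>j\<le>N div 2. bessel_term m j B * (D ^ (N - 2 * j) / fact (N - 2 * j)))"

definition ferrers_fun :: "nat \<Rightarrow> nat \<Rightarrow> real \<Rightarrow> real" where
  "ferrers_fun n m t = sin t ^ m * poly (ferrers_poly n m) (cos t)"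

lemma fourier_coeff_sphere_basis:
  "fourier_coeff m N (cos t * cos u) (sin t * sin u) = (sin t * sin u / 2) ^ m
     * (\<Sum>j\<le>N div 2. sphere_coeff m N j
          * poly (sphere_basis N j) (cos t) * poly (sphere_basis N j) (cos u))"
proof -
  have weight: "1 - cos v * cos v = sin v * sin v" for v :: real
    using sin_cos_squared_add[of v] by (simp add: power2_eq_square)
  have "4 ^ j = (2 :: real) ^ j * 2 ^ j" for j
    by (simp flip: power_mult_distrib)
  then have summand: "bessel_term m j (sin t * sin u) * ((cos t * cos u) ^ l / fact l)
      = (sin t * sin u / 2) ^ m * (1 / (4 ^ j * fact j * fact (m + j) * fact l)
          * (sin t * sin t) ^ j * cos t ^ l * (sin u * sin u) ^ j * cos u ^ l)" for j l
    by (simp add: bessel_term_def power_mult_distrib power_add power_divide power_mult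
        power2_eq_square mult_ac)
  show ?thesis
    unfolding fourier_coeff_def summand
    by (simp add: sphere_coeff_def sphere_basis_def weight sum_distrib_left mult.assoc)
qed

lemma funk_hecke_power:
  assumes "m \<le> n"
  shows "((\<lambda>t. fourier_coeff m N (cos t * cos u) (sin t * sin u) * (ferrers_fun n m t * sin t))
     has_integral funk_hecke_coeff n m N * ferrers_fun n m u) {0..pi}"
proof -
  let ?p = "ferrers_poly n m" and ?c = "sphere_coeff m N" and ?b = "sphere_basis N"
  have "((\<lambda>t. (sin u / 2) ^ m * (\<Sum>j\<le>N div 2. (?c j * poly (?b j) (cos u))
        * (sin t ^ (2 * m + 1) * (poly (?b j) (cos t) * poly ?p (cos t)))))
      has_integral (sin u / 2) ^ m
        * (\<Sum>j\<le>N div 2. (?c j * poly (?b j) (cos u)) * gegenbauer_form m (?b j) ?p)) {0..pi}"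
    by (intro has_integral_mult_right has_integral_sum has_integral_gegenbauer_form finite_atMost)
  also have "(\<lambda>t. (sin u / 2) ^ m * (\<Sum>j\<le>N div 2. (?c j * poly (?b j) (cos u))
        * (sin t ^ (2 * m + 1) * (poly (?b j) (cos t) * poly ?p (cos t)))))
      = (\<lambda>t. fourier_coeff m N (cos t * cos u) (sin t * sin u) * (ferrers_fun n m t * sin t))"
  proof -
    have "sin t ^ (2 * m + 1) = sin t ^ m * sin t ^ m * sin t" for t :: real
      by (simp add: mult_2 power_add)
    then show ?thesis
      unfolding fourier_coeff_sphere_basis ferrers_fun_def sum_distrib_left sum_distrib_right
      by (intro ext sum.cong refl) (simp only: power_divide power_mult_distrib, simp)
  qed
  also have "(\<Sum>j\<le>N div 2. (?c j * poly (?b j) (cos u)) * gegenbauer_form m (?b j) ?p)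
      = 2 ^ m * funk_hecke_coeff n m N * poly ?p (cos u)"
    unfolding gegenbauer_form_sphere_kernel[OF assms, symmetric] by (simp add: mult_ac)
  also have "(sin u / 2) ^ m * \<dots> = funk_hecke_coeff n m N * ferrers_fun n m u"
    by (simp add: ferrers_fun_def power_divide)
  finally show ?thesis .
qed

section \<open>Series for the Legendre functions\<close>

lemma tendsto_shifted_of_nat_ratio:
  fixes a c :: "'a :: real_normed_field"
  shows "(\<lambda>k. (a + of_nat k) / (c + of_nat k)) \<longlonglongrightarrow> 1"
proof -
  have at_infinity: "filterlim (\<lambda>k. c + of_nat k) at_infinity sequentially"
    by (intro tendsto_add_filterlim_at_infinity[OF tendsto_const] tendsto_of_nat)
  have "(\<lambda>k. 1 + (a - c) / (c + of_nat k)) \<longlonglongrightarrow> 1 + 0"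
    by (intro tendsto_add tendsto_const tendsto_divide_0[OF tendsto_const at_infinity])
  moreover have "\<forall>\<^sub>F k in sequentially.
      1 + (a - c) / (c + of_nat k) = (a + of_nat k) / (c + of_nat k)"
    using filterlim_at_infinity_imp_eventually_ne[OF at_infinity, of 0]
    by eventually_elim (simp add: field_simps)
  ultimately show ?thesis
    by (auto intro: Lim_transform_eventually)
qed

definition hyper_term :: "complex \<Rightarrow> complex \<Rightarrow> complex \<Rightarrow> complex \<Rightarrow> nat \<Rightarrow> complex" where
  "hyper_term a b c x k = pochhammer a k * pochhammer b k * rGamma (c + of_nat k) / fact k * x ^ k"

lemma hyperF_eq_suminf: "hyperF a b c x = (\<Sum>k. hyper_term a b c x k)"
  unfolding hyperF_def hyper_term_def ..

lemma hyper_term_Suc: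
  assumes "c + of_nat k \<noteq> 0"
  shows "hyper_term a b c x (Suc k)
    = (a + of_nat k) / (1 + of_nat k) * ((b + of_nat k) / (c + of_nat k)) * x
      * hyper_term a b c x k"
proof -
  have "rGamma (c + of_nat k) = (c + of_nat k) * rGamma (c + of_nat (Suc k))"
    using rGamma_plus1[of "c + of_nat k"] by (simp add: add_ac)
  then show ?thesis
    using assms by (simp add: hyper_term_def pochhammer_Suc flip: of_nat_Suc)
qed

lemma hyperF_sums:
  assumes "norm x < 1"
  shows "hyper_term a b c x sums hyperF a b c x"
proof -
  define q where "q k = (a + of_nat k) / (1 + of_nat k) * ((b + of_nat k) / (c + of_nat k)) * x"
    for k
  obtain \<rho> where \<rho>: "norm x < \<rho>" "\<rho> < 1"
    using assms dense by blast
  have "q \<longlonglongrightarrow> 1 * 1 * x"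
    unfolding q_def by (intro tendsto_mult tendsto_const tendsto_shifted_of_nat_ratio)
  then have "(\<lambda>k. norm (q k)) \<longlonglongrightarrow> norm x"
    by (intro tendsto_norm) simp
  then have "\<forall>\<^sub>F k in sequentially. norm (q k) < \<rho>"
    using \<rho>(1) by (rule order_tendstoD)
  moreover have "filterlim (\<lambda>k. c + of_nat k) at_infinity sequentially"
    by (intro tendsto_add_filterlim_at_infinity[OF tendsto_const] tendsto_of_nat)
  then have "\<forall>\<^sub>F k in sequentially. c + of_nat k \<noteq> 0"
    by (rule filterlim_at_infinity_imp_eventually_ne)
  ultimately have "\<forall>\<^sub>F k in sequentially.
      norm (hyper_term a b c x (Suc k)) \<le> \<rho> * norm (hyper_term a b c x k)"
  proof eventually_elim
    case (elim k)
    then show ?case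
      unfolding hyper_term_Suc[OF elim(2)] q_def[symmetric] norm_mult
      by (intro mult_right_mono) simp_all
  qed
  then obtain K
    where "\<And>k. K \<le> k \<Longrightarrow> norm (hyper_term a b c x (Suc k)) \<le> \<rho> * norm (hyper_term a b c x k)"
    by (auto simp: eventually_sequentially)
  with \<rho>(2) have "summable (hyper_term a b c x)"
    by (rule summable_ratio_test)
  then show ?thesis
    unfolding hyperF_eq_suminf by (rule summable_sums)
qed

lemma add_of_nat_notin_nonpos_Ints:
  fixes a :: "'a :: ring_char_0"
  assumes "a \<notin> \<int>\<^sub>\<le>\<^sub>0"
  shows "a + of_nat k \<notin> \<int>\<^sub>\<le>\<^sub>0"
  using assms nonpos_Ints_diff_Nats[of "a + of_nat k" "of_nat k"] by auto

text \<open>For \<open>Re a > 0\<close> and \<open>x > 0\<close> this is the integral of \<open>t powr (a - 1) * exp (- x * t)\<close> over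
  \<open>t > 0\<close>, so that its \<open>k\<close>-th derivative in \<open>x\<close> is \<open>(-1) ^ k * scaled_Gamma (a + k) x\<close>.\<close>
definition scaled_Gamma :: "complex \<Rightarrow> real \<Rightarrow> complex" where
  "scaled_Gamma a x = Gamma a * complex_of_real x powr (- a)"

lemma scaled_Gamma_mult:
  assumes "c > 0" and "x > 0"
  shows "scaled_Gamma a (c * x) = complex_of_real c powr (- a) * scaled_Gamma a x"
  using assms by (simp add: scaled_Gamma_def powr_times_real_left)

lemma powr_minus_add_of_nat:
  assumes "x \<noteq> (0 :: complex)"
  shows "x powr (- (a + of_nat k)) = x powr (- a) / x ^ k"
  using assms by (simp add: powr_diff powr_nat')

lemma scaled_Gamma_add_of_nat:
  assumes "a \<notin> \<int>\<^sub>\<le>\<^sub>0" and "x > 0"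
  shows "scaled_Gamma (a + of_nat k) x = scaled_Gamma a x * pochhammer a k / of_real x ^ k"
proof -
  have "Gamma (a + of_nat k) = Gamma a * pochhammer a k"
    using assms(1) by (simp add: pochhammer_Gamma Gamma_eq_zero_iff)
  then show ?thesis
    unfolding scaled_Gamma_def using assms(2) by (subst powr_minus_add_of_nat) simp_all
qed

lemma scaled_Gamma_taylor_sums:
  assumes "a \<notin> \<int>\<^sub>\<le>\<^sub>0" and "\<bar>D\<bar> < z"
  shows "(\<lambda>k. scaled_Gamma (a + of_nat k) z * of_real (D ^ k / fact k)) sums scaled_Gamma a (z - D)"
proof -
  have "z > 0" using assms(2) by linarith
  define w where "w = complex_of_real D / of_real z"
  have "norm (- w) < 1"
    using assms(2) \<open>z > 0\<close> by (simp add: w_def norm_divide)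
  then have "(\<lambda>k. scaled_Gamma a z * ((- a gchoose k) * (- w) ^ k))
      sums (scaled_Gamma a z * (1 + - w) powr (- a))"
    by (intro sums_mult gen_binomial_complex)
  also have "(\<lambda>k. scaled_Gamma a z * ((- a gchoose k) * (- w) ^ k))
      = (\<lambda>k. scaled_Gamma (a + of_nat k) z * of_real (D ^ k / fact k))"
  proof
    fix k
    have "(- a gchoose k) * (- w) ^ k = ((- 1) * (- w)) ^ k * pochhammer a k / fact k"
      unfolding gbinomial_pochhammer power_mult_distrib by simp
    then show "scaled_Gamma a z * ((- a gchoose k) * (- w) ^ k)
        = scaled_Gamma (a + of_nat k) z * of_real (D ^ k / fact k)"
      by (simp add: scaled_Gamma_add_of_nat[OF assms(1) \<open>z > 0\<close>] w_def power_divide)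
  qed
  also have "scaled_Gamma a z * (1 + - w) powr (- a) = scaled_Gamma a ((1 - D / z) * z)"
    using scaled_Gamma_mult[of "1 - D / z" z a] assms(2) \<open>z > 0\<close> by (simp add: w_def)
  also have "(1 - D / z) * z = z - D"
    using \<open>z > 0\<close> by (simp add: field_simps)
  finally show ?thesis .
qed

lemma scaled_Gamma_taylor_norm_summable:
  assumes "a \<notin> \<int>\<^sub>\<le>\<^sub>0" and "\<bar>D\<bar> < z"
  shows "summable (\<lambda>k. norm (scaled_Gamma (a + of_nat k) z * of_real (D ^ k / fact k)))"
proof -
  obtain y where y: "\<bar>D\<bar> < y" "y < z" using assms(2) dense by blast
  then have "summable (\<lambda>k. scaled_Gamma (a + of_nat k) z / fact k * of_real y ^ k)"
    using scaled_Gamma_taylor_sums[OF assms(1), of y z] by (simp add: sums_iff)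
  then have "summable (\<lambda>k. norm (scaled_Gamma (a + of_nat k) z / fact k * of_real D ^ k))"
    by (rule powser_insidea) (use y in auto)
  then show ?thesis by simp
qed

lemma scaled_Gamma_taylor_has_sum:
  assumes "a \<notin> \<int>\<^sub>\<le>\<^sub>0" and "\<bar>D\<bar> < z"
  shows "((\<lambda>k. scaled_Gamma (a + of_nat k) z * of_real (D ^ k / fact k))
    has_sum scaled_Gamma a (z - D)) UNIV"
  using scaled_Gamma_taylor_norm_summable[OF assms] scaled_Gamma_taylor_sums[OF assms]
  by (rule norm_summable_imp_has_sum)

definition LegendreQ_core :: "complex \<Rightarrow> complex \<Rightarrow> real \<Rightarrow> complex" where
  "LegendreQ_core a c x = scaled_Gamma a x * hyperF ((a + 1) / 2) (a / 2) c (1 / (of_real x)\<^sup>2)"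

lemma LegendreQ_of_real:
  "LegendreQ \<mu> \<nu> (of_real x) = exp (\<mu> * of_real pi * \<i>) * of_real (sqrt pi) / 2 powr (\<nu> + 1)
     * of_real (x\<^sup>2 - 1) powr (\<mu> / 2) * LegendreQ_core (\<nu> + \<mu> + 1) (\<nu> + 3 / 2) x"
proof -
  have parameter: "(\<nu> + \<mu>) / 2 + 1 = (\<nu> + \<mu> + 1 + 1) / 2"
    by (simp add: field_simps)
  show ?thesis
    unfolding LegendreQ_def LegendreQ_core_def scaled_Gamma_def parameter powr_minus
    by (simp only: divide_inverse inverse_mult_distrib mult_ac of_real_diff of_real_power of_real_1)
qed

lemma LegendreQ_core_sums:
  assumes "a \<notin> \<int>\<^sub>\<le>\<^sub>0" and "x > 1"
  shows "(\<lambda>j. scaled_Gamma (a + of_nat (2 * j)) x * (rGamma (c + of_nat j) / (4 ^ j * fact j)))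
     sums LegendreQ_core a c x"
proof -
  let ?h = "hyper_term ((a + 1) / 2) (a / 2) c (1 / (complex_of_real x)\<^sup>2)"
  have "norm (1 / (complex_of_real x)\<^sup>2) < 1"
    using assms(2) one_less_power[of x 2] by (simp add: norm_divide norm_power)
  then have "(\<lambda>j. scaled_Gamma a x * ?h j) sums LegendreQ_core a c x"
    unfolding LegendreQ_core_def by (intro sums_mult hyperF_sums)
  also have "(\<lambda>j. scaled_Gamma a x * ?h j)
      = (\<lambda>j. scaled_Gamma (a + of_nat (2 * j)) x * (rGamma (c + of_nat j) / (4 ^ j * fact j)))"
  proof
    fix j
    have "pochhammer a (2 * j) = 4 ^ j * (pochhammer ((a + 1) / 2) j * pochhammer (a / 2) j)"
      using pochhammer_double[of "a / 2" j] by (simp add: power_mult add_divide_distrib)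
    then have "scaled_Gamma (a + of_nat (2 * j)) x = scaled_Gamma a x
        * (4 ^ j * (pochhammer ((a + 1) / 2) j * pochhammer (a / 2) j) * (1 / (of_real x)\<^sup>2) ^ j)"
      using scaled_Gamma_add_of_nat[OF assms(1), of x "2 * j"] assms(2)
      by (simp add: power_mult power_one_over)
    then show "scaled_Gamma a x * ?h j
        = scaled_Gamma (a + of_nat (2 * j)) x * (rGamma (c + of_nat j) / (4 ^ j * fact j))"
      by (simp add: hyper_term_def)
  qed
  finally show ?thesis .
qed

lemma hyperF_ferrers:
  "hyperF (of_nat n + 1) (- of_nat n) (1 - of_nat m) (of_real ((1 - x) / 2))
     = of_real ((1 - x) ^ m * poly (ferrers_poly n m) x)"
proof -
  define u where "u = (1 - x) / 2"
  define f where "f = hyper_term (of_nat n + 1) (- of_nat n) (1 - of_nat m) (of_real u)"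
  have low: "f k = 0" if "k < m" for k
  proof -
    have "1 - of_nat m + of_nat k = - (of_nat (m - 1 - k) :: complex)"
      using that by (simp add: of_nat_diff)
    then show ?thesis by (simp add: f_def hyper_term_def rGamma_eq_zero_iff)
  qed
  have high: "f k = 0" if "n < k" for k
    using that by (simp add: f_def hyper_term_def pochhammer_of_nat_eq_0_iff)
  have shifted: "f (m + i) = of_real ((2 * u) ^ m * (ferrers_coeff n m i * u ^ i))" for i
  proof -
    have "rGamma (1 - of_nat m + of_nat (m + i)) = (1 / fact i :: complex)"
      using Gamma_fact[of i, where ?'a = complex] by (simp add: rGamma_inverse_Gamma divide_inverse)
    moreover have "pochhammer (of_nat n + 1) k = complex_of_real (pochhammer (real n + 1) k)"
      "pochhammer (- of_nat n) k = complex_of_real (pochhammer (- real n) k)" for k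
      by (simp_all flip: pochhammer_of_real)
    ultimately show ?thesis
      by (simp add: f_def hyper_term_def ferrers_coeff_def power_add power_mult_distrib)
  qed
  have "hyperF (of_nat n + 1) (- of_nat n) (1 - of_nat m) (of_real u) = (\<Sum>k\<in>{m..m + n}. f k)"
    unfolding hyperF_eq_suminf f_def[symmetric]
    by (intro suminf_finite) (auto simp: not_le intro: low high)
  also have "\<dots> = (\<Sum>i\<le>n. f (m + i))"
    by (rule sum.reindex_bij_witness[of _ "\<lambda>i. m + i" "\<lambda>k. k - m"]) auto
  also have "\<dots> = of_real ((2 * u) ^ m * poly (ferrers_poly n m) x)"
    unfolding shifted poly_ferrers_poly u_def[symmetric] by (simp add: sum_distrib_left)
  also have "2 * u = 1 - x"
    by (simp add: u_def)
  finally show ?thesis unfolding u_def .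
qed

lemma FerrersP_cos:
  assumes "0 < t" and "t < pi"
  shows "FerrersP (of_nat m) (of_nat n) (cos t) = of_real (ferrers_fun n m t)"
proof -
  have "sin t > 0" using assms by (rule sin_gt_zero)
  have "cos t < 1"
    using assms cos_monotone_0_pi[of 0 t] by simp
  define y where "y = sin t / (1 - cos t)"
  have "y > 0" using \<open>sin t > 0\<close> \<open>cos t < 1\<close> by (simp add: y_def)
  have "(sin t)\<^sup>2 = (1 + cos t) * (1 - cos t)"
    by (simp add: sin_squared_eq power2_eq_square algebra_simps)
  then have "(1 + cos t) / (1 - cos t) = y * y"
    using \<open>cos t < 1\<close> by (simp add: y_def power2_eq_square)
  then have "complex_of_real ((1 + cos t) / (1 - cos t)) powr (of_nat m / 2)
      = of_real y powr of_nat m"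
    using \<open>y > 0\<close> by (simp add: powr_times_real_left flip: powr_add)
  also have "\<dots> = of_real (y ^ m)"
    using \<open>y > 0\<close> by (simp add: powr_nat')
  finally have "FerrersP (of_nat m) (of_nat n) (cos t)
      = of_real ((y * (1 - cos t)) ^ m * poly (ferrers_poly n m) (cos t))"
    unfolding FerrersP_def hyperF_ferrers by (simp add: power_mult_distrib)
  also have "y * (1 - cos t) = sin t"
    using \<open>cos t < 1\<close> by (simp add: y_def)
  finally show ?thesis by (simp add: ferrers_fun_def)
qed

section \<open>Summation of the kernel\<close>

lemma abs_bessel_term_le:
  assumes "\<bar>B\<bar> \<le> 2"
  shows "\<bar>bessel_term m j B\<bar> \<le> \<bar>B\<bar> ^ (2 * j) / fact (2 * j)"
proof -
  have "real ((2 * j) choose j) \<le> real (2 ^ (2 * j))"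
    by (intro of_nat_mono binomial_le_pow2)
  then have "real ((2 * j) choose j) \<le> 4 ^ j"
    by (simp add: power_mult)
  then have "1 / (fact j * fact j) \<le> 4 ^ j / (fact (2 * j) :: real)"
    by (simp add: binomial_fact field_simps)
  moreover have "1 / (fact j * fact (m + j)) \<le> (1 / (fact j * fact j) :: real)"
    by (intro divide_left_mono mult_left_mono fact_mono) auto
  ultimately have "1 / (fact j * fact (m + j)) \<le> 4 ^ j / (fact (2 * j) :: real)"
    by (rule order_trans[rotated])
  moreover have "(\<bar>B\<bar> / 2) ^ (m + 2 * j) \<le> (\<bar>B\<bar> / 2) ^ (2 * j)"
    using assms by (intro power_decreasing) auto
  ultimately have "(\<bar>B\<bar> / 2) ^ (m + 2 * j) * (1 / (fact j * fact (m + j)))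
      \<le> (\<bar>B\<bar> / 2) ^ (2 * j) * (4 ^ j / fact (2 * j))"
    by (intro mult_mono) auto
  then show ?thesis
    by (simp add: bessel_term_def abs_mult power_abs power_divide power_mult)
qed

lemma sum_abs_fourier_coeff_le:
  assumes "\<bar>D\<bar> + \<bar>B\<bar> \<le> 1"
  shows "(\<Sum>j\<le>N div 2. \<bar>bessel_term m j B * (D ^ (N - 2 * j) / fact (N - 2 * j))\<bar>) \<le> 1 / fact N"
proof -
  define h where "h i = real (N choose i) * \<bar>B\<bar> ^ i * \<bar>D\<bar> ^ (N - i)" for i
  have "\<bar>bessel_term m j B * (D ^ (N - 2 * j) / fact (N - 2 * j))\<bar> \<le> h (2 * j) / fact N"
    if "j \<le> N div 2" for j
  proof -
    have "\<bar>bessel_term m j B\<bar> * (\<bar>D\<bar> ^ (N - 2 * j) / fact (N - 2 * j))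
        \<le> \<bar>B\<bar> ^ (2 * j) / fact (2 * j) * (\<bar>D\<bar> ^ (N - 2 * j) / fact (N - 2 * j))"
      using assms by (intro mult_right_mono abs_bessel_term_le) auto
    also have "\<dots> = h (2 * j) / fact N"
      using that by (simp add: h_def binomial_fact)
    finally show ?thesis by (simp add: abs_mult power_abs)
  qed
  then have "(\<Sum>j\<le>N div 2. \<bar>bessel_term m j B * (D ^ (N - 2 * j) / fact (N - 2 * j))\<bar>)
      \<le> (\<Sum>j\<le>N div 2. h (2 * j) / fact N)"
    by (intro sum_mono) simp
  also have "\<dots> = (\<Sum>i\<in>(*) 2 ` {..N div 2}. h i / fact N)"
    by (subst sum.reindex) (auto simp: inj_on_def)
  also have "\<dots> \<le> (\<Sum>i\<le>N. h i / fact N)"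
    by (intro sum_mono2) (auto simp: h_def)
  also have "\<dots> = (\<bar>B\<bar> + \<bar>D\<bar>) ^ N / fact N"
    by (simp add: h_def binomial_ring sum_divide_distrib)
  also have "\<dots> \<le> 1 / fact N"
    using assms by (intro divide_right_mono power_le_one) auto
  finally show ?thesis .
qed

lemma abs_fourier_coeff_le:
  assumes "\<bar>D\<bar> + \<bar>B\<bar> \<le> 1"
  shows "\<bar>fourier_coeff m N D B\<bar> \<le> 1 / fact N"
  unfolding fourier_coeff_def
  using sum_abs sum_abs_fourier_coeff_le[OF assms] by (rule order_trans)

lemma scaled_Gamma_div_fact_summable_on:
  assumes "a \<notin> \<int>\<^sub>\<le>\<^sub>0" and "z > 1"
  shows "(\<lambda>N. norm (scaled_Gamma (a + of_nat N) z) * (1 / fact N)) summable_on UNIV"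
  using scaled_Gamma_taylor_norm_summable[OF assms(1), of 1 z] assms(2)
  by (intro norm_summable_imp_summable_on) (simp add: norm_mult norm_divide)

text \<open>With \<open>a = s + m\<close> this is the \<open>m\<close>-th Fourier coefficient of
  \<open>\<Gamma>(s) (z - D - B cos \<phi>) powr (- s)\<close>, expanded in powers of \<open>D + B cos \<phi>\<close>.\<close>
definition fourier_kernel :: "complex \<Rightarrow> nat \<Rightarrow> real \<Rightarrow> real \<Rightarrow> real \<Rightarrow> complex" where
  "fourier_kernel a m z D B =
     (\<Sum>\<^sub>\<infinity>N. scaled_Gamma (a + of_nat N) z * of_real (fourier_coeff m N D B))"

lemma fourier_kernel_double_series:
  assumes "a \<notin> \<int>\<^sub>\<le>\<^sub>0" and "z > 1" and "\<bar>D\<bar> + \<bar>B\<bar> \<le> 1"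
  shows "((\<lambda>(N, j). scaled_Gamma (a + of_nat N) z
        * of_real (bessel_term m j B * (D ^ (N - 2 * j) / fact (N - 2 * j))))
     has_sum fourier_kernel a m z D B) (SIGMA N:UNIV. {..N div 2})"
proof -
  define g where "g N = scaled_Gamma (a + of_nat N) z" for N
  define e where "e N j = bessel_term m j B * (D ^ (N - 2 * j) / fact (N - 2 * j))" for N j
  define h where "h = (\<lambda>(N, j). g N * complex_of_real (e N j))"
  have row: "((\<lambda>j. norm (h (N, j))) has_sum (norm (g N) * (\<Sum>j\<le>N div 2. \<bar>e N j\<bar>))) {..N div 2}" for N
    by (rule has_sum_finiteI) (simp_all add: h_def norm_mult sum_distrib_left)
  have "(\<lambda>x. norm (h x)) summable_on (SIGMA N:UNIV. {..N div 2})"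
  proof (rule summable_on_SigmaI[OF row])
    show "(\<lambda>N. norm (g N) * (\<Sum>j\<le>N div 2. \<bar>e N j\<bar>)) summable_on UNIV"
    proof (rule summable_on_comparison_test)
      show "(\<lambda>N. norm (g N) * (1 / fact N)) summable_on UNIV"
        unfolding g_def by (rule scaled_Gamma_div_fact_summable_on[OF assms(1,2)])
      show "norm (g N) * (\<Sum>j\<le>N div 2. \<bar>e N j\<bar>) \<le> norm (g N) * (1 / fact N)" for N
        unfolding e_def by (intro mult_left_mono sum_abs_fourier_coeff_le assms(3) norm_ge_zero)
    qed (auto intro!: mult_nonneg_nonneg sum_nonneg)
  qed auto
  then have "h summable_on (SIGMA N:UNIV. {..N div 2})"
    by (rule abs_summable_summable)
  then obtain S where h_sum: "(h has_sum S) (SIGMA N:UNIV. {..N div 2})"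
    by (auto simp: summable_on_def)
  then have "((\<lambda>N. g N * of_real (fourier_coeff m N D B)) has_sum S) UNIV"
    by (rule has_sum_SigmaD)
       (auto simp: h_def e_def fourier_coeff_def sum_distrib_left intro!: has_sum_finiteI)
  then have "fourier_kernel a m z D B = S"
    unfolding fourier_kernel_def g_def by (rule infsumI)
  with h_sum show ?thesis unfolding h_def g_def e_def by simp
qed

lemma fourier_kernel_has_sum:
  assumes "a \<notin> \<int>\<^sub>\<le>\<^sub>0" and "z > 1" and "\<bar>D\<bar> + \<bar>B\<bar> \<le> 1"
  shows "((\<lambda>j. of_real (bessel_term m j B) * scaled_Gamma (a + of_nat (2 * j)) (z - D))
     has_sum fourier_kernel a m z D B) UNIV"
proof -
  define h where "h = (\<lambda>(N, j). scaled_Gamma (a + of_nat N) z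
    * complex_of_real (bessel_term m j B * (D ^ (N - 2 * j) / fact (N - 2 * j))))"
  let ?reindex = "\<lambda>(j :: nat, l :: nat). (l + 2 * j, j)"
  have "bij_betw ?reindex (UNIV \<times> UNIV) (SIGMA N:UNIV. {..N div 2})"
    by (rule bij_betw_byWitness[where f' = "\<lambda>(N, j). (j, N - 2 * j)"]) auto
  then have "((\<lambda>x. h (?reindex x)) has_sum fourier_kernel a m z D B) (UNIV \<times> UNIV)"
    using fourier_kernel_double_series[OF assms] unfolding h_def by (subst has_sum_reindex_bij_betw)
  then show ?thesis
  proof (rule has_sum_SigmaD)
    fix j
    have "\<bar>D\<bar> < z" using assms(2,3) by linarith
    from scaled_Gamma_taylor_has_sum[OF add_of_nat_notin_nonpos_Ints[OF assms(1)] this, of "2 * j"]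
    have "((\<lambda>l. of_real (bessel_term m j B)
          * (scaled_Gamma (a + of_nat (2 * j) + of_nat l) z * of_real (D ^ l / fact l)))
        has_sum of_real (bessel_term m j B) * scaled_Gamma (a + of_nat (2 * j)) (z - D)) UNIV"
      by (rule has_sum_cmult_right)
    then show "((\<lambda>l. h (?reindex (j, l)))
        has_sum of_real (bessel_term m j B) * scaled_Gamma (a + of_nat (2 * j)) (z - D)) UNIV"
      by (simp add: h_def mult_ac add_ac)
  qed
qed

lemma bessel_term_scaled_Gamma_mult:
  assumes "B > 0" and "x > 0"
  shows "of_real B powr s
       * (of_real (bessel_term m j B) * scaled_Gamma (s + of_nat m + of_nat (2 * j)) (B * x))
     = scaled_Gamma (s + of_nat m + of_nat (2 * j)) x
       * (rGamma (of_nat m + 1 + of_nat j) / (4 ^ j * fact j)) / 2 ^ m"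
proof -
  let ?a = "s + of_nat m + of_nat (2 * j)"
  have "complex_of_real B \<noteq> 0" using assms(1) by simp
  then have "of_real B powr (- ?a) = of_real B powr (- s) / of_real B ^ (m + 2 * j)"
    using powr_minus_add_of_nat[of "of_real B" s "m + 2 * j"] by (simp add: add_ac)
  then have scaled: "of_real B powr s * scaled_Gamma ?a (B * x)
      = scaled_Gamma ?a x / of_real B ^ (m + 2 * j)"
    unfolding scaled_Gamma_mult[OF assms] using \<open>complex_of_real B \<noteq> 0\<close> by (simp add: powr_minus)
  have "(2 :: complex) ^ (m + 2 * j) = 2 ^ m * 4 ^ j"
    by (simp add: power_add power_mult)
  moreover have "rGamma (of_nat m + 1 + of_nat j) = (1 / fact (m + j) :: complex)"
    using Gamma_fact[of "m + j", where 'a = complex]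
    by (simp add: rGamma_inverse_Gamma divide_inverse add_ac)
  ultimately have bessel: "of_real (bessel_term m j B) / of_real B ^ (m + 2 * j)
      = rGamma (of_nat m + 1 + of_nat j) / (4 ^ j * fact j) / (2 ^ m :: complex)"
    using assms(1) by (simp add: bessel_term_def power_divide)
  have "of_real B powr s * (of_real (bessel_term m j B) * scaled_Gamma ?a (B * x))
      = of_real (bessel_term m j B) * (of_real B powr s * scaled_Gamma ?a (B * x))"
    by (rule mult.left_commute)
  also have "\<dots> = scaled_Gamma ?a x * (of_real (bessel_term m j B) / of_real B ^ (m + 2 * j))"
    unfolding scaled by simp
  finally show ?thesis
    unfolding bessel by simp
qed

lemma fourier_kernel_eq_LegendreQ_core:
  assumes "s + of_nat m \<notin> \<int>\<^sub>\<le>\<^sub>0" and "z > 1" and "B > 0" and "\<bar>D\<bar> + B \<le> 1"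
  shows "of_real B powr s * fourier_kernel (s + of_nat m) m z D B
     = LegendreQ_core (s + of_nat m) (of_nat m + 1) ((z - D) / B) / 2 ^ m"
proof -
  define x where "x = (z - D) / B"
  have "z - D = B * x" and "x > 1"
    using assms by (auto simp: x_def field_simps)
  have "(\<lambda>j. of_real B powr s
      * (of_real (bessel_term m j B) * scaled_Gamma (s + of_nat m + of_nat (2 * j)) (z - D)))
    sums (of_real B powr s * fourier_kernel (s + of_nat m) m z D B)"
    using assms by (intro sums_mult has_sum_imp_sums fourier_kernel_has_sum) auto
  moreover have "(\<lambda>j. of_real B powr s
      * (of_real (bessel_term m j B) * scaled_Gamma (s + of_nat m + of_nat (2 * j)) (z - D)))
    sums (LegendreQ_core (s + of_nat m) (of_nat m + 1) x / 2 ^ m)"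
    unfolding \<open>z - D = B * x\<close>
      bessel_term_scaled_Gamma_mult[OF assms(3) less_trans[OF zero_less_one \<open>x > 1\<close>]]
    by (intro sums_divide LegendreQ_core_sums assms(1) \<open>x > 1\<close>)
  ultimately show ?thesis
    unfolding x_def by (rule sums_unique2)
qed

lemma has_integral_infsum_Weierstrass:
  fixes f :: "'i \<Rightarrow> 'a :: ordered_euclidean_space \<Rightarrow> 'b :: banach"
  assumes "\<And>i. continuous_on {a..b} (f i)"
    and "\<And>i t. t \<in> {a..b} \<Longrightarrow> norm (f i t) \<le> M i" and "M summable_on UNIV"
    and "\<And>i. (f i has_integral I i) {a..b}"
  obtains J where "(I has_sum J) UNIV" and "((\<lambda>t. \<Sum>\<^sub>\<infinity>i. f i t) has_integral J) {a..b}"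
proof -
  have "uniform_limit {a..b} (\<lambda>X t. \<Sum>i\<in>X. f i t) (\<lambda>t. \<Sum>\<^sub>\<infinity>i. f i t) (finite_subsets_at_top UNIV)"
    using assms(2,3) by (intro Weierstrass_m_test_general)
  then obtain P J where partial: "\<And>X. ((\<lambda>t. \<Sum>i\<in>X. f i t) has_integral P X) {a..b}"
    and total: "((\<lambda>t. \<Sum>\<^sub>\<infinity>i. f i t) has_integral J) {a..b}"
    and limit: "(P \<longlongrightarrow> J) (finite_subsets_at_top UNIV)"
    using assms(1) by (rule uniform_limit_integral[OF _ continuous_on_sum]) auto
  have "P X = sum I X" if "finite X" for X
    using has_integral_unique[OF partial has_integral_sum[OF that assms(4)]] .
  then have "(I has_sum J) UNIV"
    unfolding has_sum_def
    by (intro Lim_transform_eventually[OF limit])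
       (auto simp: eventually_finite_subsets_at_top intro!: exI[of _ "{}"])
  with total that show ?thesis by blast
qed

lemma abs_cos_sin_product_le: "\<bar>cos t * cos u\<bar> + \<bar>sin t * sin u\<bar> \<le> (1 :: real)"
proof -
  have "2 * (\<bar>x\<bar> * \<bar>y\<bar>) \<le> x\<^sup>2 + y\<^sup>2" for x y :: real
    using zero_le_power2[of "\<bar>x\<bar> - \<bar>y\<bar>"] by (simp add: power2_diff)
  from this[of "cos t" "cos u"] this[of "sin t" "sin u"] show ?thesis
    using sin_cos_squared_add[of t] sin_cos_squared_add[of u] unfolding abs_mult by linarith
qed

lemma funk_hecke_coeff_series:
  assumes "m \<le> n" and "s + of_nat m \<notin> \<int>\<^sub>\<le>\<^sub>0" and "z > 1"
    and "((\<lambda>N. scaled_Gamma (s + of_nat m + of_nat N) z * of_real (funk_hecke_coeff n m N * C))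
      has_sum J) UNIV"
  shows "J = of_real (sqrt pi / 2 ^ n * C)
    * LegendreQ_core (s + of_nat n) (of_nat n + 3 / 2) z"
proof -
  let ?f = "\<lambda>N. scaled_Gamma (s + of_nat m + of_nat N) z * of_real (funk_hecke_coeff n m N * C)"
  let ?i = "\<lambda>j. n - m + 2 * j"
  let ?g = "\<lambda>j. of_real (sqrt pi / 2 ^ n * C) * (scaled_Gamma (s + of_nat n + of_nat (2 * j)) z
      * (rGamma (of_nat n + 3 / 2 + of_nat j) / (4 ^ j * fact j)))"
  have "(?f has_sum J) (range ?i) \<longleftrightarrow> (?f has_sum J) UNIV"
    using funk_hecke_coeff_eq_0 by (intro has_sum_cong_neutral) auto
  with assms(4) have "(?f has_sum J) (range ?i)"
    by blast
  then have "(?f \<circ> ?i has_sum J) UNIV"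
    by (subst (asm) has_sum_reindex) (auto simp: inj_on_def)
  moreover have "?f \<circ> ?i = ?g"
  proof
    fix j
    have "s + of_nat m + of_nat (?i j) = s + of_nat n + of_nat (2 * j)"
      using assms(1) by (simp add: of_nat_diff)
    moreover have "rGamma (of_nat n + 3 / 2 + of_nat j)
        = complex_of_real (rGamma (real n + 3 / 2 + real j))"
      by (simp flip: rGamma_complex_of_real)
    ultimately show "(?f \<circ> ?i) j = ?g j"
      by (simp only: o_apply funk_hecke_coeff_even) simp
  qed
  ultimately have "?g sums J"
    by (simp only: has_sum_imp_sums)
  moreover have "s + of_nat n \<notin> \<int>\<^sub>\<le>\<^sub>0"
    using add_of_nat_notin_nonpos_Ints[OF assms(2), of "n - m"] assms(1) by (simp add: of_nat_diff)
  then have "?g sums (of_real (sqrt pi / 2 ^ n * C)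
      * LegendreQ_core (s + of_nat n) (of_nat n + 3 / 2) z)"
    by (intro sums_mult LegendreQ_core_sums assms(3))
  ultimately show ?thesis by (rule sums_unique2)
qed

lemma continuous_on_ferrers_fun [continuous_intros]: "continuous_on A (ferrers_fun n m)"
  unfolding ferrers_fun_def by (intro continuous_intros)

lemma ferrers_fun_sin_bounded:
  obtains C where "\<And>t. t \<in> {a..b} \<Longrightarrow> \<bar>ferrers_fun n m t * sin t\<bar> \<le> C"
proof -
  have "bounded ((\<lambda>t. ferrers_fun n m t * sin t) ` {a..b})"
    by (intro compact_imp_bounded compact_continuous_image compact_Icc continuous_intros)
  then obtain C where "\<forall>y \<in> (\<lambda>t. ferrers_fun n m t * sin t) ` {a..b}. norm y \<le> C"
    unfolding bounded_iff by blast
  then show ?thesis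
    by (intro that[of C]) simp
qed

lemma funk_hecke_fourier_kernel:
  assumes "m \<le> n" and "s + of_nat m \<notin> \<int>\<^sub>\<le>\<^sub>0" and "z > 1"
  shows "((\<lambda>t. fourier_kernel (s + of_nat m) m z (cos t * cos u) (sin t * sin u)
        * of_real (ferrers_fun n m t * sin t))
     has_integral of_real (sqrt pi / 2 ^ n * ferrers_fun n m u)
       * LegendreQ_core (s + of_nat n) (of_nat n + 3 / 2) z) {0..pi}"
proof -
  define g where "g N = scaled_Gamma (s + of_nat m + of_nat N) z" for N
  define v where "v N t = fourier_coeff m N (cos t * cos u) (sin t * sin u)" for N t
  define p where "p t = ferrers_fun n m t * sin t" for t
  obtain C where p_bound: "\<And>t. t \<in> {0..pi} \<Longrightarrow> \<bar>p t\<bar> \<le> C"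
    unfolding p_def using ferrers_fun_sin_bounded[where a = 0 and b = pi] by blast
  obtain J
    where sum: "((\<lambda>N. g N * of_real (funk_hecke_coeff n m N * ferrers_fun n m u)) has_sum J) UNIV"
    and integral: "((\<lambda>t. \<Sum>\<^sub>\<infinity>N. g N * of_real (v N t * p t)) has_integral J) {0..pi}"
  proof (rule has_integral_infsum_Weierstrass)
    show "continuous_on {0..pi} (\<lambda>t. g N * complex_of_real (v N t * p t))" for N
      unfolding v_def p_def fourier_coeff_def bessel_term_def by (intro continuous_intros) auto
    show "norm (g N * complex_of_real (v N t * p t)) \<le> norm (g N) * (1 / fact N) * C"
      if "t \<in> {0..pi}" for N t
      unfolding norm_mult norm_of_real abs_mult mult.assoc v_def
      by (intro mult_left_mono mult_mono abs_fourier_coeff_le abs_cos_sin_product_le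
          p_bound that) auto
    show "(\<lambda>N. norm (g N) * (1 / fact N) * C) summable_on UNIV"
      unfolding g_def by (intro summable_on_cmult_left scaled_Gamma_div_fact_summable_on assms)
    show "((\<lambda>t. g N * complex_of_real (v N t * p t))
        has_integral g N * of_real (funk_hecke_coeff n m N * ferrers_fun n m u)) {0..pi}" for N
      unfolding v_def p_def
      by (intro has_integral_mult_right has_integral_of_real funk_hecke_power assms)
  qed
  have "(\<Sum>\<^sub>\<infinity>N. g N * of_real (v N t * p t))
      = fourier_kernel (s + of_nat m) m z (cos t * cos u) (sin t * sin u) * of_real (p t)" for t
    unfolding fourier_kernel_def g_def v_def by (simp add: infsum_cmult_left' flip: mult.assoc)
  with integral show ?thesis
    using funk_hecke_coeff_series[OF assms sum[unfolded g_def]] by (simp add: p_def)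
qed

section \<open>The integral\<close>

definition toroidal_factor :: "complex \<Rightarrow> complex" where
  "toroidal_factor s = exp ((s - 1 / 2) * of_real pi * \<i>) * of_real (sqrt pi) / 2 powr (1 / 2)"

lemma LegendreQ_half_integer:
  assumes "x > 1"
  shows "of_real (x\<^sup>2 - 1) powr ((1 - 2 * s) / 4)
      * LegendreQ (s - 1 / 2) (of_nat m - 1 / 2) (of_real x)
    = toroidal_factor s * (LegendreQ_core (s + of_nat m) (of_nat m + 1) x / 2 ^ m)"
proof -
  have "complex_of_real (x\<^sup>2 - 1) \<noteq> 0"
    unfolding of_real_eq_0_iff using one_less_power[OF assms, of 2] by simp
  moreover have "(1 - 2 * s) / 4 + (s - 1 / 2) / 2 = 0"
    by (simp add: field_simps)
  ultimately have weights: "of_real (x\<^sup>2 - 1) powr ((1 - 2 * s) / 4)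
      * of_real (x\<^sup>2 - 1) powr ((s - 1 / 2) / 2) = (1 :: complex)"
    by (simp only: powr_add[symmetric] powr_zero_eq_one if_False)
  have parameters: "of_nat m - 1 / 2 + (s - 1 / 2) + 1 = s + of_nat m"
    "of_nat m - 1 / 2 + 3 / 2 = of_nat m + (1 :: complex)"
    "of_nat m - 1 / 2 + 1 = of_nat m + (1 / 2 :: complex)"
    by simp_all
  have powr_split: "2 powr (of_nat m + 1 / 2) = 2 ^ m * (2 powr (1 / 2) :: complex)"
    unfolding powr_add by (simp add: powr_nat')
  have "of_real (x\<^sup>2 - 1) powr ((1 - 2 * s) / 4)
      * LegendreQ (s - 1 / 2) (of_nat m - 1 / 2) (of_real x)
    = of_real (x\<^sup>2 - 1) powr ((1 - 2 * s) / 4) * of_real (x\<^sup>2 - 1) powr ((s - 1 / 2) / 2)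
      * (toroidal_factor s * (LegendreQ_core (s + of_nat m) (of_nat m + 1) x / 2 ^ m))"
    unfolding LegendreQ_of_real parameters powr_split toroidal_factor_def by (simp add: mult_ac)
  then show ?thesis
    unfolding weights by simp
qed

lemma LegendreQ_half_integer_fourier_kernel:
  fixes t u z :: real
  defines "x \<equiv> (z - cos t * cos u) / (sin t * sin u)"
  assumes "s + of_nat m \<notin> \<int>\<^sub>\<le>\<^sub>0" and "z > 1" and "0 < t" "t < pi" and "0 < u" "u < pi"
  shows "of_real (x\<^sup>2 - 1) powr ((1 - 2 * s) / 4)
      * LegendreQ (s - 1 / 2) (of_nat m - 1 / 2) (of_real x) * of_real (sin t) powr (1 - s)
    = toroidal_factor s * of_real (sin u) powr s
      * (fourier_kernel (s + of_nat m) m z (cos t * cos u) (sin t * sin u) * of_real (sin t))"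
proof -
  let ?B = "sin t * sin u"
  let ?K = "fourier_kernel (s + of_nat m) m z (cos t * cos u) ?B"
  have "sin t > 0" and "sin u > 0"
    using assms by (simp_all add: sin_gt_zero)
  then have "?B > 0" by simp
  have abs_le: "\<bar>cos t * cos u\<bar> + ?B \<le> 1"
    using abs_cos_sin_product_le[of t u] \<open>?B > 0\<close> by simp
  then have "x > 1"
    using \<open>?B > 0\<close> assms(3) by (simp add: x_def)
  have "of_real ?B powr s * of_real (sin t) powr (1 - s)
      = of_real (sin u) powr s * (of_real (sin t) powr s * complex_of_real (sin t) powr (1 - s))"
    using \<open>sin t > 0\<close> \<open>sin u > 0\<close> by (simp add: powr_times_real_left)
  also have "\<dots> = of_real (sin u) powr s * of_real (sin t)"
    using \<open>sin t > 0\<close> by (simp flip: powr_add)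
  finally have sine_powers: "of_real ?B powr s * of_real (sin t) powr (1 - s)
      = of_real (sin u) powr s * complex_of_real (sin t)" .
  have "of_real (x\<^sup>2 - 1) powr ((1 - 2 * s) / 4)
        * LegendreQ (s - 1 / 2) (of_nat m - 1 / 2) (of_real x) * of_real (sin t) powr (1 - s)
      = toroidal_factor s * (of_real ?B powr s * ?K) * of_real (sin t) powr (1 - s)"
    unfolding LegendreQ_half_integer[OF \<open>x > 1\<close>]
    by (simp only: fourier_kernel_eq_LegendreQ_core[OF assms(2,3) \<open>?B > 0\<close> abs_le] x_def)
  also have "\<dots> = toroidal_factor s * (of_real ?B powr s * of_real (sin t) powr (1 - s)) * ?K"
    by (simp only: mult_ac)
  finally show ?thesis
    unfolding sine_powers by (simp only: mult_ac)
qed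

lemma toroidal_factor_eq: "toroidal_factor s = \<i> * exp ((s - 1) * of_real pi * \<i>)
    * of_real (sqrt pi) * (2 powr (1 / 2) / 2)"
proof -
  have "exp ((s - 1 / 2) * of_real pi * \<i>) = exp ((s - 1) * of_real pi * \<i> + \<i> * (of_real pi / 2))"
    by (simp add: algebra_simps)
  also have "\<dots> = \<i> * exp ((s - 1) * of_real pi * \<i>)"
    using cis_conv_exp[of "pi / 2"] by (simp add: exp_add)
  finally have shifted: "exp ((s - 1 / 2) * of_real pi * \<i>) = \<i> * exp ((s - 1) * of_real pi * \<i>)" .
  have "2 powr (1 / 2) / 2 = 1 / (2 powr (1 / 2) :: complex)"
    by (simp add: field_simps flip: powr_add)
  then show ?thesis
    unfolding toroidal_factor_def shifted by (simp only: times_divide_eq_right mult_1_right)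
qed

lemma LegendreQ_integer:
  assumes "w > 0" and "z\<^sup>2 - 1 = w\<^sup>2"
  shows "\<i> * of_real (sqrt pi) / 2 powr (1 / 2 - s) * of_real (2 * w) powr (1 - s)
      * LegendreQ (s - 1) (of_nat n) (of_real z)
    = toroidal_factor s
      * (of_real (sqrt pi / 2 ^ n) * LegendreQ_core (s + of_nat n) (of_nat n + 3 / 2) z)"
proof -
  let ?E = "exp ((s - 1) * of_real pi * \<i>)"
  let ?L = "of_real (sqrt pi / 2 ^ n) * LegendreQ_core (s + of_nat n) (of_nat n + 3 / 2) z"
  have "complex_of_real (z\<^sup>2 - 1) powr ((s - 1) / 2) = of_real w powr (s - 1)"
    using assms powr_times_real_left[of "of_real w" "of_real w" "(s - 1) / 2"]
    by (simp add: power2_eq_square flip: powr_add)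
  moreover have "complex_of_real (2 * w) powr (1 - s) = 2 powr (1 - s) * of_real w powr (1 - s)"
    using powr_times_real_left[of 2 "of_real w" "1 - s"] by simp
  moreover have "complex_of_real w powr (1 - s) * of_real w powr (s - 1) = 1"
    using assms(1) by (simp flip: powr_add)
  moreover have "2 powr (1 - s) = 2 powr (1 / 2 - s) * (2 powr (1 / 2) :: complex)"
    by (simp flip: powr_add)
  ultimately have powers: "of_real (2 * w) powr (1 - s) * of_real (z\<^sup>2 - 1) powr ((s - 1) / 2)
      = 2 powr (1 / 2 - s) * (2 powr (1 / 2) :: complex)"
    by simp
  have powr_Suc: "2 powr (of_nat n + 1) = (2 ^ n * 2 :: complex)"
    by (simp add: powr_add powr_nat')
  have parameter: "of_nat n + (s - 1) + 1 = s + of_nat n" by simp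
  have "\<i> * of_real (sqrt pi) / 2 powr (1 / 2 - s) * of_real (2 * w) powr (1 - s)
      * LegendreQ (s - 1) (of_nat n) (of_real z)
    = \<i> * ?E * of_real (sqrt pi) / 2 powr (1 / 2 - s)
      * (of_real (2 * w) powr (1 - s) * of_real (z\<^sup>2 - 1) powr ((s - 1) / 2)) * ?L / 2"
    unfolding LegendreQ_of_real parameter powr_Suc by (simp add: mult_ac)
  also have "\<dots> = toroidal_factor s * ?L"
    unfolding powers toroidal_factor_eq by (simp add: mult_ac)
  finally show ?thesis .
qed

lemma funk_hecke_LegendreQ:
  fixes s :: complex and z w u :: real
  assumes "m \<le> n" and "s + of_nat m \<notin> \<int>\<^sub>\<le>\<^sub>0" and "z > 1" and "w > 0" and "z\<^sup>2 - 1 = w\<^sup>2"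
    and "0 < u" and "u < pi"
  shows "((\<lambda>t. let x = (z - cos t * cos u) / (sin t * sin u)
        in of_real (x\<^sup>2 - 1) powr ((1 - 2 * s) / 4)
           * LegendreQ (s - 1 / 2) (of_nat m - 1 / 2) (of_real x)
           * FerrersP (of_nat m) (of_nat n) (cos t) * of_real (sin t) powr (1 - s))
     has_integral \<i> * of_real (sqrt pi) / (2 powr (1 / 2 - s) * of_real (sin u) powr (- s))
       * of_real (2 * w) powr (1 - s) * LegendreQ (s - 1) (of_nat n) (of_real z)
       * FerrersP (of_nat m) (of_nat n) (cos u)) {0..pi}" (is "(?f has_integral ?I) _")
proof -
  let ?\<kappa> = "toroidal_factor s * of_real (sin u) powr s"
  let ?g = "\<lambda>t. fourier_kernel (s + of_nat m) m z (cos t * cos u) (sin t * sin u)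
    * of_real (ferrers_fun n m t * sin t)"
  let ?J = "of_real (sqrt pi / 2 ^ n * ferrers_fun n m u)
    * LegendreQ_core (s + of_nat n) (of_nat n + 3 / 2) z"
  have "((\<lambda>t. ?\<kappa> * ?g t) has_integral ?\<kappa> * ?J) {0..pi}"
    by (intro has_integral_mult_right funk_hecke_fourier_kernel assms)
  also have "?\<kappa> * ?J = of_real (sin u) powr s * (\<i> * of_real (sqrt pi) / 2 powr (1 / 2 - s)
      * of_real (2 * w) powr (1 - s) * LegendreQ (s - 1) (of_nat n) (of_real z))
    * FerrersP (of_nat m) (of_nat n) (cos u)"
    unfolding LegendreQ_integer[OF assms(4,5)] FerrersP_cos[OF assms(6,7)] by simp
  also have "\<dots> = ?I"
    by (simp only: powr_minus divide_inverse inverse_mult_distrib inverse_inverse_eq mult_ac)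
  finally show ?thesis
  proof (rule has_integral_spike_finite[of "{0, pi}", rotated 2])
    fix t assume "t \<in> {0..pi} - {0, pi}"
    then have "0 < t" and "t < pi" by auto
    then show "?f t = ?\<kappa> * ?g t"
      using arg_cong[OF LegendreQ_half_integer_fourier_kernel[OF assms(2,3) _ _ assms(6,7), of t],
          of "\<lambda>c. c * of_real (ferrers_fun n m t)"]
      unfolding Let_def FerrersP_cos[OF \<open>0 < t\<close> \<open>t < pi\<close>] by (simp add: mult_ac)
  qed simp
qed

lemma uminus_half_add_of_nat_notin_nonpos_Ints:
  fixes \<nu> :: "'a :: field_char_0"
  assumes "\<forall>k::nat. \<nu> \<noteq> of_nat (2 * m + 2 * k)"
  shows "- \<nu> / 2 + of_nat m \<notin> \<int>\<^sub>\<le>\<^sub>0"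
proof
  assume "- \<nu> / 2 + of_nat m \<in> \<int>\<^sub>\<le>\<^sub>0"
  then obtain k where "- \<nu> / 2 + of_nat m = - of_nat k"
    by (rule nonpos_Ints_cases')
  then have "\<nu> = of_nat (2 * m + 2 * k)"
    by (simp add: field_simps add_eq_0_iff2)
  with assms show False by blast
qed

lemma sum_power2_gt_twice_mult:
  fixes r r' :: real
  assumes "0 < r" and "0 < r'" and "r \<noteq> r'"
  shows "(r\<^sup>2 + r'\<^sup>2) / (2 * r * r') > 1"
proof -
  have "(r - r')\<^sup>2 > 0" using assms by simp
  then show ?thesis
    using assms by (simp add: power2_eq_square algebra_simps)
qed

lemma power2_max_min_quotient:
  fixes r r' :: real
  assumes "0 < r" and "0 < r'"
  shows "((r\<^sup>2 + r'\<^sup>2) / (2 * r * r'))\<^sup>2 - 1 = (((max r r')\<^sup>2 - (min r r')\<^sup>2) / (2 * r * r'))\<^sup>2"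
proof -
  have numerator: "((max r r')\<^sup>2 - (min r r')\<^sup>2)\<^sup>2 = (r\<^sup>2 + r'\<^sup>2)\<^sup>2 - (2 * r * r')\<^sup>2"
    by (auto simp: max_def min_def power2_eq_square algebra_simps)
  show ?thesis
    unfolding power_divide numerator using assms by (simp add: diff_divide_distrib)
qed

theorem theorem3p1:
  fixes n m :: nat and \<nu> :: complex and r r' \<theta>' :: real
  assumes "m \<le> n"
    and "\<forall>k::nat. \<nu> \<noteq> of_nat (2 * m + 2 * k)"
    and "0 < r" and "0 < r'" and "r \<noteq> r'"
    and "0 < \<theta>'" and "\<theta>' < pi"
  shows "((\<lambda>\<theta>. let chi = (r\<^sup>2 + r'\<^sup>2 - 2 * r * r' * cos \<theta> * cos \<theta>')
                         / (2 * r * r' * sin \<theta> * sin \<theta>')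
            in complex_of_real (chi\<^sup>2 - 1) powr ((\<nu> + 1) / 4)
               * LegendreQ (- (\<nu> + 1) / 2) (of_nat m - 1 / 2) (complex_of_real chi)
               * FerrersP (of_nat m) (of_nat n) (cos \<theta>)
               * complex_of_real (sin \<theta>) powr ((\<nu> + 2) / 2))
         has_integral
          (\<i> * of_real (sqrt pi)
             / (2 powr ((\<nu> + 1) / 2) * complex_of_real (sin \<theta>') powr (\<nu> / 2))
             * complex_of_real (((max r r')\<^sup>2 - (min r r')\<^sup>2) / (r * r')) powr ((\<nu> + 2) / 2)
             * LegendreQ (- (\<nu> + 2) / 2) (of_nat n)
                 (complex_of_real ((r\<^sup>2 + r'\<^sup>2) / (2 * r * r')))
             * FerrersP (of_nat m) (of_nat n) (cos \<theta>'))) {0..pi}"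
proof -
  define s where "s = - \<nu> / 2"
  define z where "z = (r\<^sup>2 + r'\<^sup>2) / (2 * r * r')"
  define w where "w = ((max r r')\<^sup>2 - (min r r')\<^sup>2) / (2 * r * r')"
  have exponents: "(\<nu> + 1) / 4 = (1 - 2 * s) / 4" "(\<nu> + 1) / 2 = 1 / 2 - s" "(\<nu> + 2) / 2 = 1 - s"
    "- (\<nu> + 1) / 2 = s - 1 / 2" "- (\<nu> + 2) / 2 = s - 1" "\<nu> / 2 = - s"
    by (simp_all add: s_def field_simps)
  have chi: "(r\<^sup>2 + r'\<^sup>2 - 2 * r * r' * cos t * cos \<theta>') / (2 * r * r' * sin t * sin \<theta>')
      = (z - cos t * cos \<theta>') / (sin t * sin \<theta>')" for t
    using assms(3,4) by (simp add: z_def diff_divide_distrib)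
  have quotient: "((max r r')\<^sup>2 - (min r r')\<^sup>2) / (r * r') = 2 * w"
    using assms(3,4) by (simp add: w_def field_simps)
  have "s + of_nat m \<notin> \<int>\<^sub>\<le>\<^sub>0"
    unfolding s_def using assms(2) by (rule uminus_half_add_of_nat_notin_nonpos_Ints)
  moreover have "z > 1" and "z\<^sup>2 - 1 = w\<^sup>2"
    using assms sum_power2_gt_twice_mult power2_max_min_quotient by (simp_all add: z_def w_def)
  moreover have "w > 0"
    using assms by (auto simp: w_def max_def min_def intro!: divide_pos_pos power_strict_mono)
  ultimately show ?thesis
    using funk_hecke_LegendreQ[OF assms(1), of s z w \<theta>'] assms(6,7)
    unfolding chi exponents quotient z_def[symmetric] by blast
qed

end
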